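(* Given $p,a\in\mathbb{N}$, let \[ \mathfrak{n}_{a,p} = \left\{ \begin{pmatrix} 0 & A_{12} & A_{13} & \dots & A_{1,p+1} \\ & 0 & A_{23} & \dots & A_{2,p+1} \\ & & \ddots & & \vdots\\ & 0 & & & A_{p,p+1} \\ & & & & 0 \end{pmatrix} : A_{ij} \in M_a(\mathrm{k}) \text{ for } 1 \leq i < j \leq p+1 \right\}, \] the Lie algebra (under the commutator) of strictly block upper triangular matrices of size $(p+1)a$ with blocks of size $a\times a$. Then \[ \mu(\mathfrak{n}_{a,p})= (p + 1)a . \]
   Context: All Lie algebras and representations are finite dimensional over a field $\mathrm{k}$ of characteristic zero, and $M_a(\mathrm{k})$ denotes the $a\times a$ matrices over $\mathrm{k}$. For a Lie algebra $\mathfrak{n}$, $\mu(\mathfrak{n})=\min\{\dim V : (\pi,V)\text{ is a faithful representation of }\mathfrak{n}\}$.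
   Formalization: The case a = p = 1 is excluded, because there the algebra is one-dimensional abelian and t ↦ (t) is a faithful representation of dimension 1, so μ = 1 and not 2; p and a are taken to be positive integers. *)

theory Defs
  imports "Jordan_Normal_Form.VS_Connect"
begin

record ('k, 'g) lie_alg = "('k, 'g) module" +
  bracket :: "'g \<Rightarrow> 'g \<Rightarrow> 'g"

locale lie_algebra = vectorspace K L
  for K :: "('k, 'm) ring_scheme" and L :: "('k, 'g, 'n) lie_alg_scheme" +
  assumes bracket_closed:
      "\<lbrakk>x \<in> carrier L; y \<in> carrier L\<rbrakk> \<Longrightarrow> bracket L x y \<in> carrier L"
    and bracket_add_left:
      "\<lbrakk>x \<in> carrier L; y \<in> carrier L; z \<in> carrier L\<rbrakk> \<Longrightarrow>
        bracket L (x \<oplus>\<^bsub>L\<^esub> y) z = bracket L x z \<oplus>\<^bsub>L\<^esub> bracket L y z"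
    and bracket_add_right:
      "\<lbrakk>x \<in> carrier L; y \<in> carrier L; z \<in> carrier L\<rbrakk> \<Longrightarrow>
        bracket L x (y \<oplus>\<^bsub>L\<^esub> z) = bracket L x y \<oplus>\<^bsub>L\<^esub> bracket L x z"
    and bracket_smult_left:
      "\<lbrakk>c \<in> carrier K; x \<in> carrier L; y \<in> carrier L\<rbrakk> \<Longrightarrow>
        bracket L (c \<odot>\<^bsub>L\<^esub> x) y = c \<odot>\<^bsub>L\<^esub> bracket L x y"
    and bracket_smult_right:
      "\<lbrakk>c \<in> carrier K; x \<in> carrier L; y \<in> carrier L\<rbrakk> \<Longrightarrow>
        bracket L x (c \<odot>\<^bsub>L\<^esub> y) = c \<odot>\<^bsub>L\<^esub> bracket L x y"
    and bracket_self:
      "x \<in> carrier L \<Longrightarrow> bracket L x x = \<zero>\<^bsub>L\<^esub>"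
    and jacobi:
      "\<lbrakk>x \<in> carrier L; y \<in> carrier L; z \<in> carrier L\<rbrakk> \<Longrightarrow>
        bracket L x (bracket L y z) \<oplus>\<^bsub>L\<^esub> bracket L y (bracket L z x)
          \<oplus>\<^bsub>L\<^esub> bracket L z (bracket L x y) = \<zero>\<^bsub>L\<^esub>"

locale lie_representation = L?: lie_algebra K L + V?: vectorspace K V
  for K :: "('k, 'm) ring_scheme" and L :: "('k, 'g, 'n) lie_alg_scheme"
    and V :: "('k, 'v, 'w) module_scheme" +
  fixes rep :: "'g \<Rightarrow> 'v \<Rightarrow> 'v"
  assumes rep_linear:
      "x \<in> carrier L \<Longrightarrow> rep x \<in> LinearCombinations.module_hom K V V"
    and rep_add:
      "\<lbrakk>x \<in> carrier L; y \<in> carrier L; v \<in> carrier V\<rbrakk> \<Longrightarrow>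
        rep (x \<oplus>\<^bsub>L\<^esub> y) v = rep x v \<oplus>\<^bsub>V\<^esub> rep y v"
    and rep_smult:
      "\<lbrakk>c \<in> carrier K; x \<in> carrier L; v \<in> carrier V\<rbrakk> \<Longrightarrow>
        rep (c \<odot>\<^bsub>L\<^esub> x) v = c \<odot>\<^bsub>V\<^esub> rep x v"
    and rep_bracket:
      "\<lbrakk>x \<in> carrier L; y \<in> carrier L; v \<in> carrier V\<rbrakk> \<Longrightarrow>
        rep (bracket L x y) v = rep x (rep y v) \<ominus>\<^bsub>V\<^esub> rep y (rep x v)"

locale faithful_representation = lie_representation +
  assumes faithful:
      "\<lbrakk>x \<in> carrier L; y \<in> carrier L; \<And>v. v \<in> carrier V \<Longrightarrow> rep x v = rep y v\<rbrakk> \<Longrightarrow> x = y"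

text \<open>
  A definition in HOL cannot range over representation spaces of all types. Here V ranges over
  all finite-dimensional vector spaces whose elements are of type \<^typ>\<open>'k vec\<close>; this
  type contains a space of every finite dimension, and lemma \<open>mu_le\<close> below shows that
  faithful representations on spaces of any other type have dimension at least \<open>mu L\<close> too.
\<close>

definition mu :: "('k :: field, 'g, 'n) lie_alg_scheme \<Rightarrow> nat" where
  "mu L = (LEAST d. \<exists>(V :: ('k, 'k vec) module) rep.
     faithful_representation class_ring L V rep \<and>
     vectorspace.fin_dim class_ring V \<and> vectorspace.dim class_ring V = d)"

text \<open>
  Indices start at 0, so the entry in row \<open>r\<close> and column \<open>s\<close> of the block in
  block row \<open>i\<close> and block column \<open>j\<close> has index \<open>(i * a + r, j * a + s)\<close>.
\<close>

definition strict_block_upper_mats :: "nat \<Rightarrow> nat \<Rightarrow> 'k :: zero mat set" where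
  "strict_block_upper_mats a p =
     {A \<in> carrier_mat ((p + 1) * a) ((p + 1) * a).
        \<forall>i \<le> p. \<forall>j \<le> i. \<forall>r < a. \<forall>s < a. A $$ (i * a + r, j * a + s) = 0}"

text \<open>The ring fields \<open>mult\<close> and \<open>one\<close> of the record play no role.\<close>

definition strict_block_upper :: "nat \<Rightarrow> nat \<Rightarrow> ('k :: field, 'k mat) lie_alg" where
  "strict_block_upper a p = \<lparr>
     carrier = strict_block_upper_mats a p,
     mult = undefined,
     one = undefined,
     zero = 0\<^sub>m ((p + 1) * a) ((p + 1) * a),
     add = (+),
     smult = (\<cdot>\<^sub>m),
     bracket = (\<lambda>A B. A * B - B * A)\<rparr>"

lemma strict_block_upper_simps:
  "carrier (strict_block_upper a p) = strict_block_upper_mats a p"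
  "zero (strict_block_upper a p) = 0\<^sub>m ((p + 1) * a) ((p + 1) * a)"
  "add (strict_block_upper a p) = (+)"
  "smult (strict_block_upper a p) = (\<cdot>\<^sub>m)"
  "bracket (strict_block_upper a p) = (\<lambda>A B. A * B - B * A)"
  by (simp_all add: strict_block_upper_def)

lemma strict_block_upper_mats_iff:
  assumes "a > 0"
  shows "A \<in> strict_block_upper_mats a p \<longleftrightarrow>
    A \<in> carrier_mat ((p + 1) * a) ((p + 1) * a) \<and>
    (\<forall>i < (p + 1) * a. \<forall>j < (p + 1) * a. j div a \<le> i div a \<longrightarrow> A $$ (i, j) = 0)"
proof -
  have blk: "i * a + r < (p + 1) * a" if "i \<le> p" "r < a" for i r
  proof -
    have "i * a + r < (i + 1) * a" using that by simp
    also have "\<dots> \<le> (p + 1) * a" using that by (intro mult_right_mono) auto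
    finally show ?thesis .
  qed
  have dv: "i div a \<le> p" if "i < (p + 1) * a" for i
    using that by (metis Suc_eq_plus1 less_Suc_eq_le less_mult_imp_div_less)
  have "A $$ (i, j) = 0"
    if "\<forall>i \<le> p. \<forall>j \<le> i. \<forall>r < a. \<forall>s < a. A $$ (i * a + r, j * a + s) = 0"
      "i < (p + 1) * a" "j < (p + 1) * a" "j div a \<le> i div a" for i j
    using that(1)[rule_format, of "i div a" "j div a" "i mod a" "j mod a"] that dv[of i] assms
    by simp
  moreover have "A $$ (i * a + r, j * a + s) = 0"
    if "\<forall>i < (p + 1) * a. \<forall>j < (p + 1) * a. j div a \<le> i div a \<longrightarrow> A $$ (i, j) = 0"
      "i \<le> p" "j \<le> i" "r < a" "s < a" for i j r s
    using that(1)[rule_format, of "i * a + r" "j * a + s"] that blk[of i r] blk[of j s] by simp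
  ultimately show ?thesis unfolding strict_block_upper_mats_def by blast
qed

lemma strict_block_upper_mats_mult:
  fixes A B :: "'k :: field mat"
  assumes A: "A \<in> strict_block_upper_mats a p" and B: "B \<in> strict_block_upper_mats a p"
  shows "A * B \<in> strict_block_upper_mats a p"
proof (cases "a = 0")
  case True
  then show ?thesis using assms by (auto simp: strict_block_upper_mats_def)
next
  case False
  then have a: "a > 0" by simp
  let ?N = "(p + 1) * a"
  have cA: "A \<in> carrier_mat ?N ?N" and cB: "B \<in> carrier_mat ?N ?N"
    using A B strict_block_upper_mats_iff[OF a] by blast+
  have "(A * B) $$ (i, j) = 0" if ij: "i < ?N" "j < ?N" "j div a \<le> i div a" for i j
  proof -
    have zA: "A $$ (k, l) = 0" if "k < ?N" "l < ?N" "l div a \<le> k div a" for k l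
      using A strict_block_upper_mats_iff[OF a] that by blast
    have zB: "B $$ (k, l) = 0" if "k < ?N" "l < ?N" "l div a \<le> k div a" for k l
      using B strict_block_upper_mats_iff[OF a] that by blast
    have "A $$ (i, l) * B $$ (l, j) = 0" if "l < ?N" for l
    proof (cases "l div a \<le> i div a")
      case True
      then show ?thesis using zA[of i l] ij that by simp
    next
      case False
      then have "j div a \<le> l div a" using ij(3) by simp
      then show ?thesis using zB[of l j] ij that by simp
    qed
    moreover have "(A * B) $$ (i, j) = (\<Sum>l = 0..<?N. A $$ (i, l) * B $$ (l, j))"
      using cA cB ij by (auto simp: scalar_prod_def)
    ultimately show ?thesis by (simp add: sum.neutral)
  qed
  then show ?thesis using cA cB by (auto simp: strict_block_upper_mats_iff[OF a])
qed

lemma strict_block_upper_lie_algebra: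
  "lie_algebra class_ring (strict_block_upper a p :: ('k :: field, 'k mat) lie_alg)"
proof -
  let ?L = "strict_block_upper a p :: ('k, 'k mat) lie_alg"
  let ?N = "(p + 1) * a"
  let ?S = "strict_block_upper_mats a p :: 'k mat set"
  note L = strict_block_upper_simps
  have blk: "i * a + r < ?N" if "i \<le> p" "r < a" for i r
  proof -
    have "i * a + r < (i + 1) * a" using that by simp
    also have "\<dots> \<le> ?N" using that by (intro mult_right_mono) auto
    finally show ?thesis .
  qed
  have car: "A \<in> carrier_mat ?N ?N" if "A \<in> ?S" for A
    using that by (simp add: strict_block_upper_mats_def)
  have zero: "0\<^sub>m ?N ?N \<in> ?S"
    using blk by (auto simp: strict_block_upper_mats_def)
  have add: "A + B \<in> ?S" if "A \<in> ?S" "B \<in> ?S" for A B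
    using that blk by (auto simp: strict_block_upper_mats_def)
  have minus: "A - B \<in> ?S" if "A \<in> ?S" "B \<in> ?S" for A B
    using that blk by (auto simp: strict_block_upper_mats_def)
  have smult: "c \<cdot>\<^sub>m A \<in> ?S" if "A \<in> ?S" for A c
    using that blk by (auto simp: strict_block_upper_mats_def)
  have group: "abelian_group ?L"
  proof (rule abelian_groupI, unfold L)
    fix A assume "A \<in> ?S"
    then show "\<exists>B \<in> ?S. B + A = 0\<^sub>m ?N ?N"
      using smult[of A "-1"] car[of A] by (intro bexI[of _ "-1 \<cdot>\<^sub>m A"]) auto
  qed (use car zero add in \<open>auto intro: comm_add_mat assoc_add_mat\<close>)
  have "module class_ring ?L"
    by (rule moduleI[OF class_cring.is_cring group], unfold L class_ring_simps)
      (auto intro: smult simp: car[THEN carrier_matD(1)] car[THEN carrier_matD(2)]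
        algebra_simps)
  then have vs: "vectorspace class_ring ?L"
    by (intro vectorspace.intro class_field)
  have jac: "(x * (y * z - z * y) - (y * z - z * y) * x)
      + (y * (z * x - x * z) - (z * x - x * z) * y)
      + (z * (x * y - y * x) - (x * y - y * x) * z) = 0\<^sub>m ?N ?N"
    if "x \<in> ?S" "y \<in> ?S" "z \<in> ?S" for x y z
  proof -
    note c = car[OF that(1)] car[OF that(2)] car[OF that(3)]
    have m: "u * v \<in> carrier_mat ?N ?N" if "u \<in> carrier_mat ?N ?N" "v \<in> carrier_mat ?N ?N"
      for u v :: "'k mat" using that by simp
    have d1: "u * (v * w - w * v) = u * (v * w) - u * (w * v)"
      if "u \<in> carrier_mat ?N ?N" "v \<in> carrier_mat ?N ?N" "w \<in> carrier_mat ?N ?N" for u v w :: "'k mat"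
      using that by (intro mult_minus_distrib_mat) auto
    have d2: "(v * w - w * v) * u = v * (w * u) - w * (v * u)"
      if "u \<in> carrier_mat ?N ?N" "v \<in> carrier_mat ?N ?N" "w \<in> carrier_mat ?N ?N" for u v w :: "'k mat"
      using that by (simp add: minus_mult_distrib_mat[of _ ?N ?N] assoc_mult_mat[of _ ?N ?N _ ?N _ ?N])
    have dims: "dim_row x = ?N" "dim_col x = ?N" "dim_row y = ?N" "dim_col y = ?N"
      "dim_row z = ?N" "dim_col z = ?N" using c by auto
    show ?thesis
      unfolding d1[OF c(1) c(2) c(3)] d1[OF c(2) c(3) c(1)] d1[OF c(3) c(1) c(2)]
        d2[OF c(1) c(2) c(3)] d2[OF c(2) c(3) c(1)] d2[OF c(3) c(1) c(2)]
      by (rule eq_matI) (simp_all add: dims del: index_mult_mat(1))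
  qed
  show ?thesis
  proof (rule lie_algebra.intro[OF vs], rule lie_algebra_axioms.intro, unfold L class_ring_simps)
    fix x y z :: "'k mat" and c :: 'k
    assume x: "x \<in> ?S" and y: "y \<in> ?S"
    note cx = car[OF x] and cy = car[OF y]
    have dims: "dim_row x = ?N" "dim_col x = ?N" "dim_row y = ?N" "dim_col y = ?N"
      using cx cy by auto
    show "x * y - y * x \<in> ?S"
      using x y by (intro minus strict_block_upper_mats_mult)
    show "c \<cdot>\<^sub>m x * y - y * (c \<cdot>\<^sub>m x) = c \<cdot>\<^sub>m (x * y - y * x)"
      using cx cy by (simp add: mult_smult_assoc_mat[OF cx cy] mult_smult_distrib[OF cy cx])
        (rule eq_matI, simp_all add: dims algebra_simps del: index_mult_mat(1))
    show "x * (c \<cdot>\<^sub>m y) - c \<cdot>\<^sub>m y * x = c \<cdot>\<^sub>m (x * y - y * x)"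
      using cx cy by (simp add: mult_smult_assoc_mat[OF cy cx] mult_smult_distrib[OF cx cy])
        (rule eq_matI, simp_all add: dims algebra_simps del: index_mult_mat(1))
    assume z: "z \<in> ?S"
    note cz = car[OF z]
    have dimz: "dim_row z = ?N" "dim_col z = ?N"
      using cz by auto
    show "(x + y) * z - z * (x + y) = x * z - z * x + (y * z - z * y)"
      by (simp add: add_mult_distrib_mat[OF cx cy cz] mult_add_distrib_mat[OF cz cx cy])
        (rule eq_matI, simp_all add: dims dimz algebra_simps del: index_mult_mat(1))
    show "x * (y + z) - (y + z) * x = x * y - y * x + (x * z - z * x)"
      by (simp add: add_mult_distrib_mat[OF cy cz cx] mult_add_distrib_mat[OF cx cy cz])
        (rule eq_matI, simp_all add: dims dimz algebra_simps del: index_mult_mat(1))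
    show "x * (y * z - z * y) - (y * z - z * y) * x
      + (y * (z * x - x * z) - (z * x - x * z) * y)
      + (z * (x * y - y * x) - (x * y - y * x) * z) = 0\<^sub>m ?N ?N"
      by (rule jac[OF x y z])
  next
    fix x :: "'k mat" assume "x \<in> ?S"
    then show "x * x - x * x = 0\<^sub>m ?N ?N" using car[of x] by auto
  qed
qed

lemma mu_le:
  fixes L :: "('k :: field, 'g, 'n) lie_alg_scheme" and V :: "('k, 'v) module"
  assumes faith: "faithful_representation class_ring L V rep" and fd: "vectorspace.fin_dim class_ring V"
  shows "mu L \<le> vectorspace.dim class_ring V"
proof -
  interpret V: vectorspace class_ring V
    using faith by (simp add: faithful_representation_def lie_representation_def)
  interpret R: faithful_representation class_ring L V rep by (rule faith)
  let ?K = "class_ring :: 'k ring"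
  obtain B where finB: "finite B" and basB: "V.basis B"
    using V.finite_basis_exists[OF fd] by blast
  have BV: "B \<subseteq> carrier V" using basB by (simp add: V.basis_def)
  define d where "d = V.dim"
  have d: "d = card B" unfolding d_def using V.dim_basis[OF finB basB] .
  obtain idx where idx: "bij_betw idx B {0..<d}"
    using ex_bij_betw_finite_nat[OF finB] d by blast
  let ?W = "module_vec TYPE('k) d"
  interpret W: vec_space "TYPE('k)" d .
  define crd :: "'k vec \<Rightarrow> 'v \<Rightarrow> 'k" where "crd w = restrict (\<lambda>b. w $ idx b) B" for w
  define psi where "psi w = V.lincomb (crd w) B" for w
  have lin: "linear_map ?K (class_ring.func_space B) V (\<lambda>c. V.lincomb c B)"
    using V.lincomb_is_linear[OF finB BV] by simp
  then have linh: "(\<lambda>c. V.lincomb c B) \<in> LinearCombinations.module_hom ?K (class_ring.func_space B) V"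
    by (simp add: linear_map_def mod_hom_def mod_hom_axioms_def)
  have cc: "crd w \<in> B \<rightarrow>\<^sub>E UNIV" for w by (simp add: crd_def)
  have psi_c: "psi w \<in> carrier V" for w
    using LinearCombinations.module_hom_closed[OF linh] cc[of w]
    by (auto simp: psi_def class_ring.func_space_def class_ring_simps)
  have idxlt: "idx b < d" if "b \<in> B" for b
    using idx that by (auto simp: bij_betw_def)
  have psi_add: "psi (v + w) = psi v \<oplus>\<^bsub>V\<^esub> psi w" if "v \<in> carrier_vec d" "w \<in> carrier_vec d" for v w
  proof -
    have "crd (v + w) = crd v \<oplus>\<^bsub>class_ring.func_space B\<^esub> crd w"
      using that idxlt by (auto simp: crd_def class_ring.func_space_def class_ring_simps fun_eq_iff)
    then show ?thesis using LinearCombinations.module_hom_add[OF linh] cc[of v] cc[of w]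
      by (simp add: psi_def class_ring.func_space_def class_ring_simps)
  qed
  have psi_smult: "psi (c \<cdot>\<^sub>v w) = c \<odot>\<^bsub>V\<^esub> psi w" if "w \<in> carrier_vec d" for c w
  proof -
    have "crd (c \<cdot>\<^sub>v w) = c \<odot>\<^bsub>class_ring.func_space B\<^esub> crd w"
      using that idxlt by (auto simp: crd_def class_ring.func_space_def class_ring_simps fun_eq_iff)
    then show ?thesis using LinearCombinations.module_hom_smult[OF linh] cc[of w]
      by (simp add: psi_def class_ring.func_space_def class_ring_simps)
  qed
  have uniq: "\<exists>!c. c \<in> B \<rightarrow>\<^sub>E UNIV \<and> V.lincomb c B = v" if "v \<in> carrier V" for v
    using V.basis_criterion[OF finB BV] basB that by (simp add: class_ring_simps)
  have crd_inj: "v = w" if "crd v = crd w" "v \<in> carrier_vec d" "w \<in> carrier_vec d" for v w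
  proof (rule eq_vecI)
    fix i assume "i < dim_vec w"
    then have "i \<in> idx ` B" using idx that by (auto simp: bij_betw_def)
    then obtain b where "b \<in> B" "i = idx b" by blast
    then show "v $ i = w $ i" using fun_cong[OF that(1), of b] by (simp add: crd_def)
  qed (use that in auto)
  have psi_inj: "v = w" if "psi v = psi w" "v \<in> carrier_vec d" "w \<in> carrier_vec d" for v w
  proof -
    have "crd v = crd w"
      using uniq[OF psi_c[of v]] cc[of v] cc[of w] that(1) unfolding psi_def by metis
    then show ?thesis using crd_inj that by blast
  qed
  have psi_surj: "\<exists>w \<in> carrier_vec d. psi w = v" if "v \<in> carrier V" for v
  proof -
    obtain c where c: "c \<in> B \<rightarrow>\<^sub>E UNIV" "V.lincomb c B = v" using uniq \<open>v \<in> carrier V\<close> by blast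
    let ?w = "vec d (\<lambda>i. c (inv_into B idx i))"
    have "crd ?w = c"
    proof
      fix b show "crd ?w b = c b"
        using c(1) idx idxlt[of b] by (auto simp: crd_def bij_betw_def PiE_def extensional_def)
    qed
    then show ?thesis using c(2) by (intro bexI[of _ ?w]) (auto simp: psi_def)
  qed
  define phi where "phi v = (SOME w. w \<in> carrier_vec d \<and> psi w = v)" for v
  have phi: "phi v \<in> carrier_vec d" "psi (phi v) = v" if "v \<in> carrier V" for v
    using someI_ex[of "\<lambda>w. w \<in> carrier_vec d \<and> psi w = v"] psi_surj[OF that]
    unfolding phi_def by blast+
  have phi_psi: "phi (psi w) = w" if "w \<in> carrier_vec d" for w
    using psi_inj phi[OF psi_c[of w]] that by blast
  have phi_add: "phi (v \<oplus>\<^bsub>V\<^esub> w) = phi v + phi w" if "v \<in> carrier V" "w \<in> carrier V" for v w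
    using that phi psi_add phi_psi by (metis add_carrier_vec)
  have phi_smult: "phi (c \<odot>\<^bsub>V\<^esub> v) = c \<cdot>\<^sub>v phi v" if "v \<in> carrier V" for v c
    using that phi psi_smult phi_psi by (metis smult_carrier_vec)
  define rep' where "rep' x w = phi (rep x (psi w))" for x w
  have rep_c: "rep x v \<in> carrier V" if "x \<in> carrier L" "v \<in> carrier V" for x v
    using LinearCombinations.module_hom_closed[OF R.rep_linear[OF that(1)]] that(2) by blast
  note rep_add_right = LinearCombinations.module_hom_add[OF R.rep_linear]
  note rep_smult_right = LinearCombinations.module_hom_smult[OF R.rep_linear]
  have Wvs: "vectorspace ?K ?W" by (rule vec_vs)
  have "lie_representation ?K L ?W rep'"
  proof (rule lie_representation.intro[OF _ Wvs])
    show "lie_algebra ?K L" by (rule R.L.lie_algebra_axioms)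
    show "lie_representation_axioms ?K L ?W rep'"
    proof (rule lie_representation_axioms.intro, unfold module_vec_simps)
      fix x assume x: "x \<in> carrier L"
      show "rep' x \<in> LinearCombinations.module_hom ?K ?W ?W"
        unfolding LinearCombinations.module_hom_def rep'_def
        using phi(1) psi_c rep_c[OF x]
        by (auto simp: module_vec_simps psi_add psi_smult rep_add_right[OF x] rep_smult_right[OF x]
            phi_add phi_smult class_ring_simps)
    next
      fix x y and v :: "'k vec" assume x: "x \<in> carrier L" and y: "y \<in> carrier L"
      show "rep' (x \<oplus>\<^bsub>L\<^esub> y) v = rep' x v + rep' y v"
        using x y by (simp add: rep'_def R.rep_add psi_c rep_c phi_add)
      show "rep' (c \<odot>\<^bsub>L\<^esub> x) v = c \<cdot>\<^sub>v rep' x v" for c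
        using x by (simp add: rep'_def R.rep_smult psi_c rep_c phi_smult class_ring_simps)
      have comm: "rep' x (rep' y v) = phi (rep x (rep y (psi v)))" if "x \<in> carrier L" "y \<in> carrier L" for x y
        using that by (simp add: rep'_def phi rep_c psi_c)
      have neg: "phi (\<ominus>\<^bsub>V\<^esub> w) = \<ominus>\<^bsub>?W\<^esub> phi w" if "w \<in> carrier V" for w
      proof -
        have "\<ominus>\<^bsub>V\<^esub> w = (- 1) \<odot>\<^bsub>V\<^esub> w"
          using V.smult_minus_1[OF that] by (simp add: class_ring_simps)
        moreover have "(- 1) \<cdot>\<^sub>v phi w = - phi w" by (rule eq_vecI) auto
        ultimately show ?thesis
          using phi_smult[OF that, of "-1"] W.vec_neg[OF phi(1)[OF that]] by simp
      qed
      show "rep' (bracket L x y) v = rep' x (rep' y v) \<ominus>\<^bsub>?W\<^esub> rep' y (rep' x v)"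
        using x y unfolding comm[OF x y] comm[OF y x] a_minus_def
        by (simp add: rep'_def R.rep_bracket psi_c rep_c a_minus_def phi_add neg module_vec_simps)
    qed
  qed
  then have "faithful_representation ?K L ?W rep'"
  proof (rule faithful_representation.intro, intro faithful_representation_axioms.intro)
    fix x y assume x: "x \<in> carrier L" and y: "y \<in> carrier L"
      and eq: "\<And>v. v \<in> carrier ?W \<Longrightarrow> rep' x v = rep' y v"
    show "x = y"
    proof (rule R.faithful[OF x y])
      fix v assume v: "v \<in> carrier V"
      have "rep' x (phi v) = rep' y (phi v)" using eq phi(1)[OF v] by (simp add: module_vec_simps)
      then have "psi (phi (rep x v)) = psi (phi (rep y v))" by (simp add: rep'_def phi(2)[OF v])
      then show "rep x v = rep y v" using phi(2) rep_c x y v by simp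
    qed
  qed
  then have "\<exists>(V :: ('k, 'k vec) module) rep. faithful_representation ?K L V rep \<and>
      vectorspace.fin_dim ?K V \<and> vectorspace.dim ?K V = d"
    using W.fin_dim W.dim_is_n by blast
  then show ?thesis unfolding mu_def d_def by (rule Least_le)
qed

text \<open>
  The case \<open>a = p = 1\<close> is exceptional: the algebra is then one-dimensional, and any nonzero
  scalar gives a faithful representation of dimension 1, which is less than \<open>(p + 1) * a = 2\<close>.
\<close>

lemma mu_strict_block_upper_1_1:
  "mu (strict_block_upper 1 1 :: ('k :: field, 'k mat) lie_alg) \<le> 1"
proof -
  let ?K = "class_ring :: 'k ring"
  let ?L = "strict_block_upper 1 1 :: ('k, 'k mat) lie_alg"
  let ?W = "module_vec TYPE('k) 1"
  let ?rep = "\<lambda>A v. A $$ (0, 1) \<cdot>\<^sub>v v :: 'k vec"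
  note L = strict_block_upper_simps
  interpret W: vec_space "TYPE('k)" 1 .
  have car: "A \<in> carrier_mat 2 2" if "A \<in> strict_block_upper_mats 1 1" for A :: "'k mat"
    using that by (simp add: strict_block_upper_mats_def numeral_2_eq_2)
  have z: "A $$ (0, 0) = 0" "A $$ (1, 0) = 0" "A $$ (1, 1) = 0"
    if "A \<in> strict_block_upper_mats 1 1" for A :: "'k mat"
    using that by (auto simp: strict_block_upper_mats_def)
  have "lie_representation ?K ?L ?W ?rep"
  proof (rule lie_representation.intro[OF strict_block_upper_lie_algebra vec_vs],
      rule lie_representation_axioms.intro, unfold L module_vec_simps class_ring_simps)
    fix x y :: "'k mat" and v :: "'k vec" and c :: 'k
    assume x: "x \<in> strict_block_upper_mats 1 1"
    show "?rep x \<in> LinearCombinations.module_hom ?K ?W ?W"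
      by (auto simp: LinearCombinations.module_hom_def module_vec_simps class_ring_simps
          smult_add_distrib_vec smult_smult_assoc mult.commute)
    assume v: "v \<in> carrier_vec 1"
    show "?rep (c \<cdot>\<^sub>m x) v = c \<cdot>\<^sub>v ?rep x v"
      using car[OF x] by (simp add: smult_smult_assoc)
    assume y: "y \<in> strict_block_upper_mats 1 1"
    show "?rep (x + y) v = ?rep x v + ?rep y v"
      using car[OF x] car[OF y] by (simp add: add_smult_distrib_vec)
    have "(x * y - y * x) $$ (0, 1) = 0"
      using car[OF x] car[OF y] z[OF x] z[OF y]
      by (simp add: scalar_prod_def numeral_2_eq_2)
    then have "?rep (x * y - y * x) v = 0\<^sub>v 1"
      using v by (intro eq_vecI) (simp_all del: index_mult_mat index_minus_mat)
    moreover have "?rep x (?rep y v) = ?rep y (?rep x v)"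
      by (simp add: smult_smult_assoc mult.commute)
    moreover have "u \<ominus>\<^bsub>?W\<^esub> u = 0\<^sub>v 1" if "u \<in> carrier_vec 1" for u
      unfolding a_minus_def W.vec_neg[OF that] module_vec_simps
      by (rule uminus_r_inv_vec[OF that])
    ultimately show "?rep (x * y - y * x) v = ?rep x (?rep y v) \<ominus>\<^bsub>?W\<^esub> ?rep y (?rep x v)"
      using v by (metis smult_carrier_vec)
  qed
  then have "faithful_representation ?K ?L ?W ?rep"
  proof (rule faithful_representation.intro, intro faithful_representation_axioms.intro, unfold L module_vec_simps)
    fix x y :: "'k mat"
    assume x: "x \<in> strict_block_upper_mats 1 1" and y: "y \<in> strict_block_upper_mats 1 1"
      and eq: "\<And>v. v \<in> carrier_vec 1 \<Longrightarrow> ?rep x v = ?rep y v"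
    have "(?rep x (vec 1 (\<lambda>_. 1))) $ 0 = (?rep y (vec 1 (\<lambda>_. 1))) $ 0"
      by (rule arg_cong[OF eq]) simp
    then have "x $$ (0, 1) = y $$ (0, 1)" by simp
    then show "x = y"
      using car[OF x] car[OF y] z[OF x] z[OF y]
      by (intro eq_matI) (auto simp: less_2_cases_iff)
  qed
  from mu_le[OF this W.fin_dim] show ?thesis by (simp only: W.dim_is_n)
qed

end

theory Submission
  imports Defs "HOL-Library.Function_Algebras"
begin

text \<open>
  Upper bound: the algebra acts faithfully on column vectors of length $(p+1)a$.

  Lower bound. Write $m = (p-1)a$, so that $(p+1)a = 2a + m$, and regroup the blocks into a
  $3 \times 3$ pattern with sizes $a, m, a$. The matrices supported in the blocks $(1,2)$, $(2,3)$,
  $(1,3)$ form a subalgebra $H$ whose commutators lie in the central corner block $Z$, of dimension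
  $a^2$. It suffices to bound the dimension $d$ of a representation of $H$ on which $Z$ is faithful.
  Throughout, $T$ is a generating set of $V$ of least cardinality $s$. A central operator that kills
  $T$ kills $V$, so $Z$ embeds into the linear maps from the span of $T$ into $V$.

  If $p = 1$ then $H = Z$ is abelian and nothing forces it to act nilpotently. If a central
  operator $z \in Z$ maps the span of $T$ into itself and $w$, $zw$ are linearly independent there,
  then $zw$ can be dropped from a basis containing both, which contradicts minimality; hence $z$ is
  scalar on the span of $T$. Comparing dimensions inside $Hom(span\,T, V)$ gives
  $a^2 + s^2 - 1 \le s d$ (lemma \<open>schur_jacobson_bound\<close>), that is,
  $a^2 \le s(d-s) + 1$, and for $a \ge 2$ this forces $d \ge 2a$.

  If $p \ge 2$, every matrix unit $z$ of $Z$ is a commutator $[x,y]$ with $x, y \in H$. In characteristic zero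
  such a $z$ acts as zero on simple subquotients (lemma \<open>central_commutator_simple\<close>). Let
  $U = ZV$ and $t = dim\,U$. Since $Z$ embeds into $Hom(span\,T, U)$, $a^2 \le s t$ and therefore
  $s + t \ge 2a$. Lemma \<open>heisenberg_bound\<close> shows in addition that $d \ge s + t + m$: modulo
  $U$, some $v \in T$ and its images under a Heisenberg algebra of degree $m$ span at least $m + 1$
  dimensions, because the operators sending $v$ into the span of $v$ and $U$ are isotropic for the
  Heisenberg form; and $v$ together with representatives of a complement of this span
  still generates $V$. So $d \ge 2a + m$.
\<close>

section \<open>Finite-dimensional subspaces\<close>

context vector_space
begin

lemma dependent_family:
  assumes "finite I" "finite B" "card B < card I" "\<And>e. e \<in> I \<Longrightarrow> w e \<in> span B"
  shows "\<exists>c. (\<exists>e\<in>I. c e \<noteq> 0) \<and> (\<Sum>e\<in>I. c e *s w e) = 0"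
proof (cases "inj_on w I")
  case True
  have "dependent (w ` I)"
  proof (rule ccontr)
    assume "independent (w ` I)"
    then have "card (w ` I) \<le> card B"
      using independent_span_bound[of B "w ` I"] assms by blast
    then show False using assms(3) card_image[OF True] by simp
  qed
  then obtain u where u: "\<exists>v\<in>w ` I. u v \<noteq> 0" "(\<Sum>v\<in>w ` I. u v *s v) = 0"
    using dependent_finite[of "w ` I"] assms(1) by auto
  then show ?thesis
    by (intro exI[of _ "u \<circ> w"]) (auto simp: sum.reindex[OF True])
next
  case False
  then obtain x y where xy: "x \<in> I" "y \<in> I" "x \<noteq> y" "w x = w y"
    by (auto simp: inj_on_def)
  let ?c = "\<lambda>e. if e = x then 1 else if e = y then - 1 else 0"
  have "(\<Sum>e\<in>I. ?c e *s w e) = (\<Sum>e\<in>{x, y}. ?c e *s w e)"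
    using xy assms(1) by (intro sum.mono_neutral_right) auto
  also have "\<dots> = 0" using xy by simp
  finally show ?thesis using xy by (intro exI[of _ ?c]) auto
qed

text \<open>
  A system of vector-valued equations is one linear relation in the space of functions
  from \<open>J\<close>, where the right-hand sides live in a subspace of dimension at most
  \<open>card J * card B\<close>.
\<close>

lemma homogeneous_system:
  assumes fin: "finite I" "finite J" "finite B" and card: "card J * card B < card I"
    and g: "\<And>e l. e \<in> I \<Longrightarrow> l \<in> J \<Longrightarrow> g e l \<in> span B"
  shows "\<exists>c. (\<exists>e\<in>I. c e \<noteq> 0) \<and> (\<forall>l\<in>J. (\<Sum>e\<in>I. c e *s g e l) = 0)"
proof -
  interpret F: vector_space "\<lambda>c (f :: 'd \<Rightarrow> 'b) l. c *s f l"
    by unfold_locales (auto simp: fun_eq_iff algebra_simps scale_right_distrib scale_left_distrib)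
  have sum_fun: "sum f A x = (\<Sum>a\<in>A. f a x)" for f :: "'e \<Rightarrow> 'd \<Rightarrow> 'b" and A x
    by (induction A rule: infinite_finite_induct) auto
  define single :: "'d \<Rightarrow> 'b \<Rightarrow> 'd \<Rightarrow> 'b" where "single l b = (\<lambda>l'. if l' = l then b else 0)" for l b
  let ?B = "case_prod single ` (J \<times> B)"
  have single: "single l b \<in> F.span ?B" if "l \<in> J" "b \<in> span B" for l b
    using that(2)
  proof (induction rule: span_induct_alt)
    case base
    have "single l 0 = (\<lambda>_. 0)" by (auto simp: single_def)
    then show ?case using F.span_zero[of ?B] by (simp only: zero_fun_def)
  next
    case (step c x y)
    have "single l (c *s x + y) = (\<lambda>l'. c *s single l x l') + single l y"
      by (auto simp: single_def)
    moreover have "single l x \<in> F.span ?B"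
      using step(1) \<open>l \<in> J\<close> by (intro F.span_base) auto
    ultimately show ?case using step by (simp only: F.span_add F.span_scale)
  qed
  let ?w = "\<lambda>e l. if l \<in> J then g e l else 0"
  have "?w e \<in> F.span ?B" if "e \<in> I" for e
  proof -
    have "?w e = (\<Sum>l\<in>J. single l (g e l))"
    proof
      fix l
      have "sum (\<lambda>l'. single l' (g e l')) J l = (\<Sum>l'\<in>J. single l' (g e l') l)"
        by (induction J rule: infinite_finite_induct) auto
      also have "\<dots> = ?w e l" using fin(2) by (simp add: single_def)
      finally show "?w e l = sum (\<lambda>l'. single l' (g e l')) J l" by simp
    qed
    also have "\<dots> \<in> F.span ?B"
      by (intro F.span_sum single) (use that g in auto)
    finally show ?thesis .
  qed
  moreover have "card ?B < card I"
    using card_image_le[of "J \<times> B" "case_prod single"] fin card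
    by (simp add: card_cartesian_product)
  ultimately obtain c where c: "\<exists>e\<in>I. c e \<noteq> 0" "(\<Sum>e\<in>I. (\<lambda>l. c e *s ?w e l)) = 0"
    using F.dependent_family[of I ?B ?w] fin by auto
  have "(\<Sum>e\<in>I. c e *s g e l) = 0" if "l \<in> J" for l
    using fun_cong[OF c(2), of l] that by (simp add: sum_fun)
  then show ?thesis using c(1) by blast
qed

end

locale fd_subspace = vector_space +
  fixes V :: "'b set"
  assumes subspace_V: "subspace V"
    and fd: "\<exists>B. finite B \<and> V \<subseteq> span B"
begin

lemma independent_finite:
  assumes "independent S" "S \<subseteq> V" shows "finite S"
proof -
  obtain B where "finite B" "V \<subseteq> span B" using fd by blast
  then show ?thesis using independent_span_bound[of B S] assms by auto
qed

lemma finite_basis: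
  assumes "subspace P" "P \<subseteq> V"
  obtains B where "B \<subseteq> P" "finite B" "independent B" "span B = P" "card B = dim P"
proof -
  obtain B where B: "B \<subseteq> P" "independent B" "P \<subseteq> span B" "card B = dim P"
    using basis_exists .
  moreover have "span B = P" using B assms by (intro span_subspace)
  moreover have "finite B" using independent_finite[of B] B assms by auto
  ultimately show ?thesis by (intro that)
qed

lemma extend_subspace:
  assumes "subspace P" "P \<subseteq> V"
  obtains F where "F \<subseteq> V" "finite F" "card F + dim P = dim V" "span (P \<union> F) = V"
proof -
  obtain B where B: "B \<subseteq> P" "finite B" "independent B" "span B = P" "card B = dim P"
    using finite_basis[OF assms] .
  obtain C where C: "B \<subseteq> C" "C \<subseteq> V" "independent C" "V \<subseteq> span C"
    using maximal_independent_subset_extend[of B V] B assms by blast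
  have fC: "finite C" using independent_finite C by blast
  have "dim V = card C" using basis_card_eq_dim[of C V] C by simp
  then have "card (C - B) + dim P = dim V"
    using C fC B card_mono[of C B] by (simp add: card_Diff_subset)
  moreover have "span (P \<union> (C - B)) = V"
  proof (rule span_subspace)
    show "V \<subseteq> span (P \<union> (C - B))"
      using C(4) span_mono[of C "P \<union> (C - B)"] B(1) B(4) span_superset[of B] by blast
  qed (use assms C subspace_V in auto)
  moreover have "C - B \<subseteq> V" "finite (C - B)" using C fC by auto
  ultimately show ?thesis by (intro that[of "C - B"])
qed

lemma dim_le:
  assumes "subspace P" "P \<subseteq> V" shows "dim P \<le> dim V"
proof -
  obtain F :: "'b set" where "card F + dim P = dim V" using extend_subspace[OF assms] by blast
  then show ?thesis by linarith
qed

lemma fd_subspace_subset: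
  assumes "subspace P" "P \<subseteq> V" shows "fd_subspace scale P"
proof unfold_locales
  show "subspace P" by fact
  obtain B where "finite B" "V \<subseteq> span B" using fd by blast
  then show "\<exists>B. finite B \<and> P \<subseteq> span B" using assms(2) by (intro exI[of _ B]) simp
qed

lemma dim_strict:
  assumes "subspace P" "subspace Q" "P \<subset> Q" "Q \<subseteq> V"
  shows "dim P < dim Q"
proof -
  obtain F where F: "F \<subseteq> Q" "finite F" "card F + dim P = dim Q" "span (P \<union> F) = Q"
    using fd_subspace.extend_subspace[OF fd_subspace_subset[OF assms(2,4)] assms(1)] assms(3) by blast
  have "span P = P" using assms(1) by simp
  then have "F \<noteq> {}" using F(4) assms(3) by (metis Un_empty_right psubset_eq)
  then have "card F > 0" using F(2) by (simp add: card_gt_0_iff)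
  then show ?thesis using F(3) by linarith
qed

lemma dim_insert_new:
  assumes "S \<subseteq> V" "x \<in> V" "x \<notin> span S"
  shows "dim (insert x S) = Suc (dim S)"
proof -
  have "span S \<subseteq> V" using assms subspace_V by (simp add: span_minimal)
  then obtain B where B: "finite B" "independent B" "span B = span S" "card B = dim S"
    using finite_basis[OF subspace_span] by (metis dim_span)
  have "x \<notin> B" using B assms span_base by metis
  moreover have "independent (insert x B)" using B assms by (simp add: independent_insertI)
  moreover have "span (insert x B) = span (insert x S)"
    using B(3) by (simp add: span_insert)
  ultimately show ?thesis using B dim_eq_card[of "insert x B" "insert x S"] by simp
qed

text \<open>
  The hypothesis is linear independence of the family modulo the span of \<open>S\<close>; this replaces
  working in a quotient space.
\<close>

lemma dim_independent_family:
  assumes "finite J" "S \<subseteq> V" "w ` J \<subseteq> V"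
    and ind: "\<And>c. (\<Sum>j\<in>J. c j *s w j) \<in> span S \<Longrightarrow> \<forall>j\<in>J. c j = 0"
  shows "dim (S \<union> w ` J) = dim S + card J"
  using assms(1,3,4)
proof (induction J rule: finite_induct)
  case empty then show ?case by simp
next
  case (insert x J)
  have ext: "(\<Sum>j\<in>insert x J. (if j = x then a else c j) *s w j) = a *s w x + (\<Sum>j\<in>J. c j *s w j)" for a c
    using insert(1,2) by (simp, intro sum.cong) auto
  have "\<forall>j\<in>J. c j = 0" if "(\<Sum>j\<in>J. c j *s w j) \<in> span S" for c
  proof
    fix j assume j: "j \<in> J"
    have "\<forall>j\<in>insert x J. (if j = x then 0 else c j) = 0"
      using ext[of 0 c] that by (intro insert.prems(2)) simp
    then show "c j = 0" using j insert(2) by (metis insertCI)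
  qed
  then have IH: "dim (S \<union> w ` J) = dim S + card J" using insert.IH insert.prems by auto
  have "w x \<notin> span (S \<union> w ` J)"
  proof
    assume "w x \<in> span (S \<union> w ` J)"
    then obtain a b where ab: "w x = a + b" "a \<in> span S" "b \<in> span (w ` J)"
      unfolding span_Un by auto
    have "\<exists>c. b = (\<Sum>j\<in>J. c j *s w j)"
      using ab(3)
    proof (induction rule: span_induct_alt)
      case base
      show ?case by (rule exI[of _ "\<lambda>_. 0"]) simp
    next
      case (step k y z)
      then obtain c j where c: "z = (\<Sum>j\<in>J. c j *s w j)" "y = w j" "j \<in> J" by auto
      have "(\<Sum>i\<in>J. (c i + (if i = j then k else 0)) *s w i) = (\<Sum>i\<in>J. c i *s w i) + (\<Sum>i\<in>J. if i = j then k *s w i else 0)"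
        unfolding sum.distrib[symmetric] by (intro sum.cong) (auto simp: scale_left_distrib)
      also have "\<dots> = k *s y + z" using c insert(1) by (simp add: sum.delta add.commute)
      finally show ?case by metis
    qed
    then obtain c where c: "b = (\<Sum>j\<in>J. c j *s w j)" by blast
    have "(\<Sum>j\<in>insert x J. (if j = x then 1 else - c j) *s w j) = a"
      unfolding ext[of 1 "\<lambda>j. - c j"] using ab c by (simp add: sum_negf)
    then have "(1::'a) = 0" using insert.prems(2)[of "\<lambda>j. if j = x then 1 else - c j"] ab(2) by auto
    then show False by simp
  qed
  then have "dim (insert (w x) (S \<union> w ` J)) = Suc (dim (S \<union> w ` J))"
    using insert.prems assms by (intro dim_insert_new) auto
  then show ?case using IH insert by simp
qed

end

section \<open>Central operators and the Schur-Jacobson bound\<close>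

locale operator_space = fd_subspace +
  fixes H :: "('b \<Rightarrow> 'b) set"
  assumes H_linear: "h \<in> H \<Longrightarrow> Vector_Spaces.linear scale scale h"
    and H_closed: "h \<in> H \<Longrightarrow> v \<in> V \<Longrightarrow> h v \<in> V"
begin

lemma H_hom: "h \<in> H \<Longrightarrow> Modules.module_hom scale scale h"
  using H_linear by (simp add: linear_iff_module_hom)

definition invariant :: "'b set \<Rightarrow> bool" where
  "invariant W \<longleftrightarrow> subspace W \<and> (\<forall>h\<in>H. \<forall>w\<in>W. h w \<in> W)"

text \<open>
  Commutation is required on the whole type: the operators that arise later
  vanish on the missing coordinates, so nothing is lost outside \<open>V\<close>.
\<close>

definition central :: "('b \<Rightarrow> 'b) \<Rightarrow> bool" where
  "central z \<longleftrightarrow> Vector_Spaces.linear scale scale z \<and> (\<forall>h\<in>H. \<forall>v. z (h v) = h (z v))"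

definition generates :: "'b set \<Rightarrow> bool" where
  "generates T \<longleftrightarrow> finite T \<and> T \<subseteq> V \<and> V \<subseteq> invariant hull T"

definition maximal_invariant :: "'b set \<Rightarrow> 'b set \<Rightarrow> bool" where
  "maximal_invariant A W \<longleftrightarrow> invariant W \<and> W \<subset> A \<and>
     (\<forall>W'. invariant W' \<longrightarrow> W \<subseteq> W' \<longrightarrow> W' \<subseteq> A \<longrightarrow> W' = W \<or> W' = A)"

lemma invariant_hull: "invariant (invariant hull T)"
  by (rule hull_in) (auto simp: invariant_def intro!: subspace_Inter)

lemma invariant_V: "invariant V"
  using subspace_V H_closed by (simp add: invariant_def)

lemma invariant_0: "invariant {0}"
  using module_hom.zero[OF H_hom] by (simp add: invariant_def)

lemma invariant_Int: "invariant A \<Longrightarrow> invariant B \<Longrightarrow> invariant (A \<inter> B)"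
  by (auto simp: invariant_def subspace_inter)

lemma central_hom: "central z \<Longrightarrow> Modules.module_hom scale scale z"
  by (simp add: central_def linear_iff_module_hom)

lemma invariant_preimage:
  assumes "central z" "invariant W"
  shows "invariant {v. z v \<in> W}"
  using assms module_hom.subspace_linear_preimage[OF central_hom[OF assms(1)], of W]
  by (auto simp: invariant_def central_def)

lemma central_sum:
  assumes "\<And>e. e \<in> I \<Longrightarrow> central (z e)"
  shows "central (\<lambda>v. \<Sum>e\<in>I. c e *s z e v)"
proof -
  have l: "Vector_Spaces.linear scale scale (z e)" if "e \<in> I" for e using assms that by (simp add: central_def)
  have "Vector_Spaces.linear scale scale (\<lambda>v. \<Sum>e\<in>I. c e *s z e v)"
    using l unfolding Vector_Spaces.linear_iff
    by (auto simp: sum.distrib scale_right_distrib scale_sum_right vector_space_axioms mult.commute intro!: sum.cong)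
  moreover have "(\<Sum>e\<in>I. c e *s z e (h v)) = h (\<Sum>e\<in>I. c e *s z e v)" if "h \<in> H" for h v
  proof -
    note h = H_hom[OF that]
    show ?thesis
      using assms that by (simp add: module_hom.sum[OF h] module_hom.scale[OF h] central_def)
  qed
  ultimately show ?thesis by (simp add: central_def)
qed

lemma central_zero_of_generates:
  assumes "central z" "generates T" "\<And>t. t \<in> T \<Longrightarrow> z t = 0" "v \<in> V"
  shows "z v = 0"
proof -
  have "invariant {v. z v \<in> {0}}" using invariant_preimage invariant_0 assms(1) by blast
  moreover have "T \<subseteq> {v. z v \<in> {0}}" using assms(3) by auto
  ultimately have "invariant hull T \<subseteq> {v. z v \<in> {0}}" by (metis hull_minimal)
  then show ?thesis using assms by (auto simp: generates_def)
qed

lemma minimal_generators: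
  obtains T where "generates T" "\<forall>T'. generates T' \<longrightarrow> card T \<le> card T'"
proof -
  obtain B where "B \<subseteq> V" "finite B" "span B = V"
    using finite_basis[OF subspace_V] by auto
  moreover have "span B \<subseteq> invariant hull B"
    by (rule span_minimal) (use invariant_hull in \<open>auto simp: invariant_def hull_subset\<close>)
  ultimately have "generates B" by (simp add: generates_def)
  then show ?thesis using ex_has_least_nat[of generates B card] that by metis
qed

lemma maximal_invariant_exists:
  assumes "invariant W0" "invariant A" "W0 \<subset> A" "A \<subseteq> V"
  obtains W where "maximal_invariant A W" "W0 \<subseteq> W"
proof -
  let ?P = "\<lambda>W. invariant W \<and> W0 \<subseteq> W \<and> W \<subset> A"
  have "\<forall>W. ?P W \<longrightarrow> dim W \<le> dim V"
    using dim_le assms(4) by (auto simp: invariant_def)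
  then obtain W where W: "?P W" "\<And>W'. ?P W' \<Longrightarrow> dim W' \<le> dim W"
    using ex_has_greatest_nat[of ?P W0 dim "Suc (dim V)"] assms by (auto simp: less_Suc_eq_le)
  have "W' = W \<or> W' = A" if "invariant W'" "W \<subseteq> W'" "W' \<subseteq> A" for W'
  proof (rule ccontr)
    assume "\<not> ?thesis"
    then have PW': "?P W'" and less: "W \<subset> W'" using that W(1) by auto
    have "dim W < dim W'"
      using less that W(1) assms(4) by (intro dim_strict) (auto simp: invariant_def)
    then show False using W(2)[OF PW'] by simp
  qed
  then have "maximal_invariant A W" using W(1) unfolding maximal_invariant_def by blast
  then show ?thesis using that W(1) by blast
qed

text \<open>
  The classical bound of Schur and Jacobson on spaces of commuting operators, over any field.
  The linear maps from the span of a minimal generating set \<open>T\<close> to \<open>V\<close> contain the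
  restrictions of the \<open>z e\<close> and the endomorphisms of the span itself. By minimality
  these two subspaces can meet only in scalars, which bounds the sum of their dimensions by
  \<open>card T * dim V + 1\<close>.
\<close>

theorem schur_jacobson_bound:
  fixes z :: "'i \<Rightarrow> 'b \<Rightarrow> 'b"
  assumes I: "finite I" and zH: "\<And>e. e \<in> I \<Longrightarrow> z e \<in> H" and z_central: "\<And>e. e \<in> I \<Longrightarrow> central (z e)"
    and faithful: "\<And>c. (\<And>v. v \<in> V \<Longrightarrow> (\<Sum>e\<in>I. c e *s z e v) = 0) \<Longrightarrow> \<forall>e\<in>I. c e = 0"
  shows "\<exists>s \<le> dim V. card I \<le> s * (dim V - s) + 1"
proof (cases "I = {}")
  case True
  then show ?thesis by auto
next
  case False
  obtain T where T: "generates T" and min: "\<forall>T'. generates T' \<longrightarrow> card T \<le> card T'"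
    using minimal_generators .
  have fT: "finite T" and TV: "T \<subseteq> V" and gT: "V \<subseteq> invariant hull T"
    using T by (auto simp: generates_def)
  have smaller: False if "finite T'" "T' \<subseteq> V" "T \<subseteq> invariant hull T'" "card T' < card T" for T'
  proof -
    have "V \<subseteq> invariant hull T'"
      using gT hull_minimal[OF that(3), of invariant] invariant_hull by blast
    then show False using min that by (auto simp: generates_def not_le[symmetric])
  qed
  have span_hull: "span S \<subseteq> invariant hull S" for S
    by (rule span_minimal) (use invariant_hull in \<open>auto simp: invariant_def hull_subset\<close>)
  have indT: "independent T"
  proof
    assume "dependent T"
    then obtain t where t: "t \<in> T" "t \<in> span (T - {t})" by (auto simp: dependent_def)
    have "T \<subseteq> invariant hull (T - {t})"
      using t span_hull hull_inc[of _ "T - {t}" invariant] by blast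
    then show False
      using smaller[of "T - {t}"] card_Diff1_less[OF fT t(1)] fT TV by blast
  qed
  have Tne: "T \<noteq> {}"
  proof
    assume "T = {}"
    moreover have "central (\<lambda>v. \<Sum>e\<in>I. 1 *s z e v)" by (intro central_sum z_central)
    ultimately have "(\<Sum>e\<in>I. 1 *s z e v) = 0" if "v \<in> V" for v
      using central_zero_of_generates T that by blast
    then have "\<forall>e\<in>I. (1 :: 'a) = 0" by (rule faithful)
    then show False using False by auto
  qed
  then obtain t0 where t0: "t0 \<in> T" by blast
  obtain B where B: "finite B" "span B = V" "card B = dim V"
    using finite_basis[OF subspace_V] by auto
  have s: "card T \<le> dim V"
    using independent_span_bound[OF B(1) indT] B TV by auto
  let ?s = "card T"
  have "card I \<le> ?s * (dim V - ?s) + 1"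
  proof (rule ccontr)
    assume big: "\<not> ?thesis"
    \<comment> \<open>Elementary endomorphisms of the span of \<open>T\<close>; omitting one diagonal position leaves
      a complement of the scalars, so the family below can be dependent only trivially.\<close>
    let ?P = "T \<times> T - {(t0, t0)}"
    let ?g = "\<lambda>k t. case k of Inl e \<Rightarrow> z e t | Inr p \<Rightarrow> if t = fst p then snd p else 0"
    have "card ?P = ?s * ?s - 1"
      using t0 fT by (simp add: card_Diff_singleton card_cartesian_product)
    then have "card (I <+> ?P) = card I + (?s * ?s - 1)"
      using I fT by (simp add: card_Plus)
    moreover have "?s * ?s \<ge> 1" using t0 fT by (simp add: Suc_le_eq card_gt_0_iff Tne)
    moreover have "?s * dim V = ?s * (dim V - ?s) + ?s * ?s"
      using s by (metis add_mult_distrib2 le_add_diff_inverse2)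
    ultimately have "card T * card B < card (I <+> ?P)" using big B(3) by simp
    moreover have "?g k t \<in> span B" if "k \<in> I <+> ?P" "t \<in> T" for k t
      using that zH H_closed TV B(2) span_zero[of B] by (auto split: sum.split)
    ultimately obtain c where c: "\<exists>k\<in>I <+> ?P. c k \<noteq> 0"
      "\<And>t. t \<in> T \<Longrightarrow> (\<Sum>k\<in>I <+> ?P. c k *s ?g k t) = 0"
      using homogeneous_system[of "I <+> ?P" T B ?g] I fT B(1) by auto
    define zc where "zc v = (\<Sum>e\<in>I. c (Inl e) *s z e v)" for v
    define b where "b t t' = (if (t, t') = (t0, t0) then 0 else c (Inr (t, t')))" for t t'
    have rel: "zc t + (\<Sum>t'\<in>T. b t t' *s t') = 0" if "t \<in> T" for t
    proof -
      have "(\<Sum>p\<in>?P. c (Inr p) *s (if t = fst p then snd p else 0))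
          = (\<Sum>p\<in>T \<times> T. b (fst p) (snd p) *s (if t = fst p then snd p else 0))"
        using fT by (intro sum.mono_neutral_cong_left) (auto simp: b_def)
      also have "\<dots> = (\<Sum>t1\<in>T. \<Sum>t'\<in>T. b t1 t' *s (if t = t1 then t' else 0))"
        by (simp add: sum.cartesian_product case_prod_beta)
      also have "\<dots> = (\<Sum>t1\<in>T. if t = t1 then \<Sum>t'\<in>T. b t t' *s t' else 0)"
        by (intro sum.cong) auto
      also have "\<dots> = (\<Sum>t'\<in>T. b t t' *s t')" using fT that by simp
      finally show ?thesis
        using c(2)[OF that] I fT by (simp add: sum.Plus zc_def o_def)
    qed
    have central_zc: "central zc"
      unfolding zc_def[abs_def] by (intro central_sum z_central)
    then have lin: "Modules.module_hom scale scale zc" by (rule central_hom)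
    have zcT: "zc w \<in> span T" if "w \<in> span T" for w
    proof -
      have "zc t \<in> span T" if "t \<in> T" for t
      proof -
        have "zc t = - (\<Sum>t'\<in>T. b t t' *s t')"
          using rel[OF that] by (simp add: eq_neg_iff_add_eq_0)
        then show ?thesis by (simp add: span_neg span_sum span_scale span_base)
      qed
      then have "span T \<subseteq> {w. zc w \<in> span T}"
        using module_hom.subspace_linear_preimage[OF lin] by (intro span_minimal) auto
      then show ?thesis using that by blast
    qed
    \<comment> \<open>Otherwise \<open>zc w\<close> is a redundant member of a basis through \<open>w\<close> and \<open>zc w\<close>.\<close>
    have scalar: "\<exists>l. zc w = l *s w" if w: "w \<in> span T" for w
    proof (rule ccontr)
      assume no: "\<not> ?thesis"
      then have "w \<noteq> 0" using module_hom.zero[OF lin] by auto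
      moreover have "zc w \<notin> span {w}" using no by (auto simp: span_singleton)
      ultimately have "independent {zc w, w}" by (simp add: independent_insert)
      then obtain C where C: "{zc w, w} \<subseteq> C" "C \<subseteq> span T" "independent C" "span T \<subseteq> span C"
        using maximal_independent_subset_extend[of "{zc w, w}" "span T"] w zcT by blast
      have "card C = card T"
        using dim_eq_card[of C T] dim_eq_card_independent[OF indT] C
        by (metis span_minimal subset_antisym subspace_span)
      moreover have CV: "C \<subseteq> V" using C(2) TV subspace_V span_minimal by blast
      moreover have fC: "finite C" using C(3) CV independent_finite by blast
      moreover have "T \<subseteq> invariant hull (C - {zc w})"
      proof -
        let ?G = "invariant hull (C - {zc w})"
        have sG: "subspace ?G" and hG: "\<And>h v. h \<in> H \<Longrightarrow> v \<in> ?G \<Longrightarrow> h v \<in> ?G"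
          using invariant_hull[of "C - {zc w}"] by (auto simp: invariant_def)
        have "w \<noteq> zc w" using no by (metis scale_one)
        then have "w \<in> ?G" using C(1) by (intro hull_inc) blast
        then have "(\<Sum>e\<in>I. c (Inl e) *s z e w) \<in> ?G"
          using zH hG sG by (intro subspace_sum subspace_scale) auto
        then have "zc w \<in> ?G" by (simp only: zc_def)
        then have "C \<subseteq> ?G" using hull_inc[of _ "C - {zc w}" invariant] by blast
        then show ?thesis using C(4) span_superset[of T] span_minimal sG by blast
      qed
      ultimately show False
        using smaller[of "C - {zc w}"] card_Diff1_less[of C "zc w"] C(1) by auto
    qed
    have zero: "zc t = 0 \<and> (\<forall>t'\<in>T. b t t' = 0)" if t: "t \<in> T" and l0: "zc t = l *s t" "l + b t t = 0 \<Longrightarrow> l = 0" for t l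
    proof -
      have "(\<Sum>t'\<in>T. (b t t' + (if t' = t then l else 0)) *s t')
        = (\<Sum>t'\<in>T. b t t' *s t') + (\<Sum>t'\<in>T. if t' = t then l *s t else 0)"
        unfolding sum.distrib[symmetric] by (intro sum.cong) (auto simp: scale_left_distrib)
      also have "\<dots> = (\<Sum>t'\<in>T. b t t' *s t') + zc t"
        using l0 t fT by simp
      also have "\<dots> = 0" using rel[OF t] by (simp add: add.commute)
      finally have *: "b t t' + (if t' = t then l else 0) = 0" if "t' \<in> T" for t'
        by (rule independentD[where u = "\<lambda>t'. b t t' + (if t' = t then l else 0)",
              OF indT fT subset_refl _ that])
      have "l = 0" using *[OF t] l0(2) by (simp add: add.commute)
      then show ?thesis using * l0(1) by (metis add.right_neutral scale_zero_left)
    qed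
    have zero0: "zc t0 = 0"
      using scalar[OF span_base[OF t0]] zero[OF t0] by (auto simp: b_def)
    \<comment> \<open>All eigenvalues agree with the one at \<open>t0\<close>, as sums \<open>t0 + t\<close> are eigenvectors too.\<close>
    have zeroT: "zc t = 0 \<and> (\<forall>t'\<in>T. b t t' = 0)" if t: "t \<in> T" for t
    proof -
      obtain l where l: "zc t = l *s t" using scalar span_base t by blast
      have "l *s t = 0"
      proof (cases "t = t0")
        case True then show ?thesis using zero0 l by simp
      next
        case False
        obtain k where k: "zc (t0 + t) = k *s (t0 + t)"
          using scalar span_add span_base t t0 by blast
        have "l *s t = k *s (t0 + t)"
          using k zero0 l by (simp add: module_hom.add[OF lin])
        then have "k *s t0 + (k - l) *s t = 0"
          by (simp add: scale_right_distrib scale_left_diff_distrib)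
        moreover have "(\<Sum>v\<in>{t0, t}. (if v = t0 then k else k - l) *s v) = k *s t0 + (k - l) *s t"
          using False by auto
        ultimately have "k = 0" "k - l = 0"
          using independentD[OF indT, of "{t0, t}" "\<lambda>v. if v = t0 then k else k - l" t0]
            independentD[OF indT, of "{t0, t}" "\<lambda>v. if v = t0 then k else k - l" t] t t0 False by auto
        then show ?thesis by simp
      qed
      then have "zc t = 0 *s t" using l by simp
      then show ?thesis using zero[OF t] by blast
    qed
    have "zc v = 0" if "v \<in> V" for v
      using central_zero_of_generates[OF central_zc T _ that] zeroT by blast
    then have "c (Inl e) = 0" if "e \<in> I" for e
      using faithful[of "\<lambda>e. c (Inl e)"] that by (auto simp: zc_def)
    moreover have "c (Inr p) = 0" if "p \<in> ?P" for p
      using that zeroT[of "fst p"] by (cases p) (auto simp: b_def split: if_splits)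
    ultimately show False using c(1) by auto
  qed
  then show ?thesis using s by blast
qed

end

section \<open>Central commutators in characteristic zero\<close>

context fd_subspace
begin

text \<open>
  Evaluation of the polynomial \<open>q\<close> at the operator \<open>x\<close>, by Horner's scheme. It is used
  for a minimal annihilating polynomial of an operator on a subquotient.
\<close>

definition poly_act :: "('b \<Rightarrow> 'b) \<Rightarrow> 'a poly \<Rightarrow> 'b \<Rightarrow> 'b" where
  "poly_act x q = fold_coeffs (\<lambda>c f v. c *s v + x (f v)) q (\<lambda>v. 0)"

context
  fixes x :: "'b \<Rightarrow> 'b"
  assumes x: "Modules.module_hom scale scale x"
begin

lemma poly_act_0 [simp]: "poly_act x 0 v = 0"
  by (simp add: poly_act_def)

lemma poly_act_pCons [simp]: "poly_act x (pCons c q) v = c *s v + x (poly_act x q v)"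
  by (cases "c = 0 \<and> q = 0") (auto simp: poly_act_def module_hom.zero[OF x])

lemma poly_act_add: "poly_act x (p + q) v = poly_act x p v + poly_act x q v"
  by (induction p q rule: poly_induct2) (simp_all add: module_hom.add[OF x] scale_left_distrib)

lemma poly_act_smult: "poly_act x (Polynomial.smult c q) v = c *s poly_act x q v"
  by (induction q) (simp_all add: module_hom.scale[OF x] scale_right_distrib)

lemma poly_act_mult: "poly_act x (p * q) v = poly_act x p (poly_act x q v)"
  by (induction p) (simp_all add: mult_pCons_left poly_act_add poly_act_smult)

lemma poly_act_sum: "poly_act x (\<Sum>i\<in>I. f i) v = (\<Sum>i\<in>I. poly_act x (f i) v)"
  by (induction I rule: infinite_finite_induct) (simp_all add: poly_act_add)

lemma poly_act_monom: "poly_act x (Polynomial.monom c n) v = c *s (x ^^ n) v"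
  by (induction n) (simp_all add: monom_0 monom_Suc module_hom.zero[OF x] module_hom.scale[OF x])

lemma poly_act_closed:
  assumes "subspace A" "\<And>w. w \<in> A \<Longrightarrow> x w \<in> A" "v \<in> A"
  shows "poly_act x q v \<in> A"
  using assms by (induction q) (simp_all add: subspace_0 subspace_add subspace_scale)

lemma module_hom_poly_act: "Modules.module_hom scale scale (poly_act x q)"
proof -
  have "poly_act x q (u + v) = poly_act x q u + poly_act x q v" for u v
    by (induction q) (simp_all add: module_hom.add[OF x] scale_right_distrib)
  moreover have "poly_act x q (c *s v) = c *s poly_act x q v" for c v
    by (induction q) (simp_all add: module_hom.scale[OF x] scale_right_distrib mult.commute)
  ultimately show ?thesis
    using x by (simp add: module_hom_iff)
qed

text \<open>
  If \<open>[x, y] = z\<close> commutes with \<open>x\<close>, then \<open>[_, y]\<close> acts on polynomials in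
  \<open>x\<close> as \<open>z\<close> times formal differentiation.
\<close>

lemma poly_act_commutator:
  assumes y: "Modules.module_hom scale scale y"
    and xy: "\<And>v. x (y v) = y (x v) + z v" and xz: "\<And>v. x (z v) = z (x v)"
    and z: "Modules.module_hom scale scale z"
  shows "poly_act x q (y v) = y (poly_act x q v) + z (poly_act x (pderiv q) v)"
proof (induction q)
  case 0
  then show ?case by (simp add: module_hom.zero[OF y] module_hom.zero[OF z])
next
  case (pCons c q)
  then show ?case
    by (simp add: pderiv_pCons poly_act_add xy xz module_hom.add[OF x] module_hom.add[OF y]
        module_hom.add[OF z] module_hom.scale[OF y] algebra_simps)
qed

end

end

context fd_subspace
begin

text \<open>
  The iterates of \<open>x\<close> at each basis vector are linearly dependent; multiplying the resulting
  polynomials gives one that works for the whole basis.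
\<close>

lemma poly_annihilator:
  assumes x: "Modules.module_hom scale scale x" and xV: "\<And>v. v \<in> V \<Longrightarrow> x v \<in> V"
  shows "\<exists>q. q \<noteq> 0 \<and> (\<forall>v\<in>V. poly_act x q v = 0)"
proof -
  note hom = module_hom_poly_act[OF x]
  obtain B where B: "B \<subseteq> V" "finite B" "span B = V" using finite_basis[OF subspace_V] by auto
  have single: "\<exists>q. q \<noteq> 0 \<and> poly_act x q v = 0" if "v \<in> V" for v
  proof -
    have "(x ^^ i) v \<in> span B" for i
      by (induction i) (use that xV B in auto)
    then obtain c where c: "\<exists>i\<in>{..card B}. c i \<noteq> 0" "(\<Sum>i\<le>card B. c i *s (x ^^ i) v) = 0"
      using dependent_family[of "{..card B}" B "\<lambda>i. (x ^^ i) v"] B(2) by auto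
    let ?q = "\<Sum>i\<le>card B. Polynomial.monom (c i) i"
    obtain i where i: "i \<le> card B" "c i \<noteq> 0" using c(1) by auto
    have "Polynomial.coeff ?q i = c i" using i by (simp add: coeff_sum sum.delta')
    then have "?q \<noteq> 0" using i by force
    moreover have "poly_act x ?q v = 0"
      using c(2) by (simp add: poly_act_sum[OF x] poly_act_monom[OF x])
    ultimately show ?thesis by blast
  qed
  have "\<exists>q. q \<noteq> 0 \<and> (\<forall>v\<in>B. poly_act x q v = 0)"
    using B(2,1)
  proof (induction B rule: finite_induct)
    case empty
    then show ?case by (intro exI[of _ 1]) simp
  next
    case (insert b B)
    then obtain q where q: "q \<noteq> 0" "\<forall>v\<in>B. poly_act x q v = 0" by auto
    obtain r where r: "r \<noteq> 0" "poly_act x r b = 0" using single[of b] insert.prems by blast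
    have "poly_act x (q * r) b = 0"
      using r by (simp add: poly_act_mult[OF x] module_hom.zero[OF hom])
    moreover have "poly_act x (q * r) v = 0" if "v \<in> B" for v
      using that q by (simp add: poly_act_mult[OF x] mult.commute[of q r] module_hom.zero[OF hom])
    ultimately show ?case using q r by (intro exI[of _ "q * r"]) auto
  qed
  then obtain q where q: "q \<noteq> 0" "\<forall>v\<in>B. poly_act x q v = 0" by blast
  have "span B \<subseteq> {v. poly_act x q v = 0}"
    using q(2) module_hom.subspace_kernel[OF hom[of q]] by (intro span_minimal) auto
  then show ?thesis using q(1) B(3) by blast
qed

end

locale operator_space_char_0 = operator_space scale V H
  for scale :: "'k::field_char_0 \<Rightarrow> 'v::ab_group_add \<Rightarrow> 'v" (infixr "*s" 75) and V H
begin

text \<open>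
  On the simple module \<open>A / W\<close> a nonzero central operator is injective. Let \<open>q\<close> be an
  annihilating polynomial of \<open>x\<close> on \<open>A / W\<close> of least degree. Taking the commutator with
  \<open>y\<close> shows that \<open>z\<close> times the derivative of \<open>q\<close>, hence the derivative itself,
  annihilates too. In characteristic zero that contradicts minimality. In characteristic
  \<open>l > 0\<close> the statement fails: on polynomials modulo \<open>X\<close> to the power \<open>l\<close>,
  differentiation and multiplication by \<open>X\<close> have commutator 1 up to sign on a simple module.
\<close>

lemma central_commutator_simple:
  assumes x: "x \<in> H" and y: "y \<in> H" and z: "central z"
    and xy: "\<And>v. x (y v) - y (x v) = z v"
    and A: "invariant A" "A \<subseteq> V" and W: "maximal_invariant A W" and a: "a \<in> A"
  shows "z a \<in> W"
proof (rule ccontr)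
  assume no: "z a \<notin> W"
  note hx = H_hom[OF x] and hy = H_hom[OF y] and hz = central_hom[OF z]
  have invW: "invariant W" "W \<subset> A" using W by (auto simp: maximal_invariant_def)
  then have sW: "subspace W" by (simp add: invariant_def)
  let ?K = "A \<inter> {v. z v \<in> W}"
  have "invariant ?K" using A invW z by (intro invariant_Int invariant_preimage)
  moreover have "W \<subseteq> ?K"
  proof -
    have "z w \<in> W" if "w \<in> W" for w
      using that invW x y sW unfolding xy[symmetric]
      by (intro subspace_diff) (auto simp: invariant_def)
    then show ?thesis using invW by auto
  qed
  ultimately have "?K = W \<or> ?K = A" using W by (auto simp: maximal_invariant_def)
  then have inj: "v \<in> W" if "v \<in> A" "z v \<in> W" for v using no a that by auto
  let ?Q = "\<lambda>q. q \<noteq> 0 \<and> (\<forall>v\<in>A. poly_act x q v \<in> W)"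
  obtain q0 where "q0 \<noteq> 0" "\<forall>v\<in>V. poly_act x q0 v = 0"
    using poly_annihilator[OF hx H_closed[OF x]] by blast
  then have "?Q q0" using A(2) subspace_0[OF sW] by auto
  then obtain q where q: "?Q q" and min: "\<And>r. ?Q r \<Longrightarrow> degree q \<le> degree r"
    using ex_has_least_nat[of ?Q q0 degree] by blast
  have "degree q \<noteq> 0"
  proof
    assume "degree q = 0"
    then obtain c where c: "q = [:c:]" by (metis degree_eq_zeroE)
    then have "c \<noteq> 0" "\<forall>v\<in>A. c *s v \<in> W" using q by (auto simp: module_hom.zero[OF hx] hx)
    then have "A \<subseteq> W" using subspace_scale[OF sW, of _ "inverse c"] by force
    then show False using invW by blast
  qed
  then have "pderiv q \<noteq> 0" by (simp add: pderiv_eq_0_iff)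
  moreover have "poly_act x (pderiv q) v \<in> W" if v: "v \<in> A" for v
  proof (rule inj)
    have xA: "x w \<in> A" if "w \<in> A" for w using A(1) x that by (simp add: invariant_def)
    have sA: "subspace A" using A(1) by (simp add: invariant_def)
    show "poly_act x (pderiv q) v \<in> A"
      by (rule poly_act_closed[OF hx sA xA v])
    have "poly_act x q (y v) = y (poly_act x q v) + z (poly_act x (pderiv q) v)"
    proof (rule poly_act_commutator[OF hx hy _ _ hz])
      show "x (y v) = y (x v) + z v" for v using xy[of v] by (simp add: algebra_simps)
      show "x (z v) = z (x v)" for v using z x by (simp add: central_def)
    qed
    then have "z (poly_act x (pderiv q) v) = poly_act x q (y v) - y (poly_act x q v)" by simp
    also have "\<dots> \<in> W"
      using q v A(1) y invW(1) by (intro subspace_diff[OF sW]) (auto simp: invariant_def)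
    finally show "z (poly_act x (pderiv q) v) \<in> W" .
  qed
  ultimately have "degree q \<le> degree (pderiv q)" by (intro min) blast
  then show False using \<open>degree q \<noteq> 0\<close> by (simp add: degree_pderiv)
qed

end

section \<open>Families of Heisenberg algebras with a common centre\<close>

context operator_space_char_0
begin

text \<open>
  Here \<open>U\<close> is the span of the images of the \<open>z e\<close>, and \<open>s\<close>, \<open>t\<close> are the least
  number of generators of \<open>V\<close> and the dimension of \<open>U\<close>. For each \<open>e\<close> the operators
  \<open>x e j\<close>, \<open>y e j\<close>, \<open>z e\<close> span a Heisenberg algebra. With \<open>U / W\<close> simple and
  \<open>v\<close> a generator such that \<open>z e v\<close> is not in \<open>W\<close>, an operator with \<open>v\<close> as an
  eigenvector modulo \<open>U\<close> acts as a scalar on \<open>U / W\<close>. Hence two such operators have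
  a commutator sending \<open>v\<close> into \<open>W\<close>. This isotropy yields \<open>m\<close> vectors
  among the \<open>x e j v\<close> and \<open>y e j v\<close> that are independent modulo \<open>v\<close> and \<open>U\<close>.
\<close>

theorem heisenberg_bound:
  fixes z :: "'i \<Rightarrow> 'v \<Rightarrow> 'v" and x y :: "'i \<Rightarrow> nat \<Rightarrow> 'v \<Rightarrow> 'v"
  assumes H_add: "\<And>f g. f \<in> H \<Longrightarrow> g \<in> H \<Longrightarrow> (\<lambda>v. f v + g v) \<in> H"
    and H_scale: "\<And>f c. f \<in> H \<Longrightarrow> (\<lambda>v. c *s f v) \<in> H"
    and I: "finite I" "I \<noteq> {}"
    and zH: "\<And>e. e \<in> I \<Longrightarrow> z e \<in> H" and z_central: "\<And>e. e \<in> I \<Longrightarrow> central (z e)"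
    and commutator: "\<And>f g. f \<in> H \<Longrightarrow> g \<in> H \<Longrightarrow>
      \<exists>c. \<forall>v. f (g v) - g (f v) = (\<Sum>e\<in>I. c e *s z e v)"
    and m: "m > 0"
    and xH: "\<And>e j. e \<in> I \<Longrightarrow> j < m \<Longrightarrow> x e j \<in> H"
    and yH: "\<And>e j. e \<in> I \<Longrightarrow> j < m \<Longrightarrow> y e j \<in> H"
    and xy: "\<And>e j l v. e \<in> I \<Longrightarrow> j < m \<Longrightarrow> l < m \<Longrightarrow>
      x e j (y e l v) - y e l (x e j v) = (if j = l then z e v else 0)"
    and yy: "\<And>e j l v. e \<in> I \<Longrightarrow> j < m \<Longrightarrow> l < m \<Longrightarrow> y e j (y e l v) = y e l (y e j v)"
    and faithful: "\<And>c. (\<And>v. v \<in> V \<Longrightarrow> (\<Sum>e\<in>I. c e *s z e v) = 0) \<Longrightarrow> \<forall>e\<in>I. c e = 0"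
  shows "\<exists>s t. card I \<le> s * t \<and> s + t + m \<le> dim V"
proof -
  have H_sum: "(\<lambda>v. \<Sum>l\<in>L. c l *s f l v) \<in> H" if "finite L" "\<And>l. l \<in> L \<Longrightarrow> f l \<in> H"
    for L :: "nat set" and c f
    using that
  proof (induction L rule: finite_induct)
    case empty
    obtain e where "e \<in> I" using I(2) by blast
    then show ?case using H_scale[OF zH, of e 0] by simp
  next
    case (insert l L)
    then show ?case using H_add[OF H_scale[of "f l" "c l"] insert.IH] by simp
  qed
  define U where "U = span (\<Union>e\<in>I. z e ` V)"
  have sU: "subspace U" by (simp add: U_def)
  have zU: "z e v \<in> U" if "e \<in> I" "v \<in> V" for e v
    unfolding U_def using that by (intro span_base) blast
  have UV: "U \<subseteq> V"
    unfolding U_def using zH H_closed by (intro span_minimal subspace_V) blast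
  have invU: "invariant U"
  proof -
    have "h u \<in> U" if h: "h \<in> H" and u: "u \<in> U" for h u
    proof -
      have "h (z e v) \<in> U" if "e \<in> I" "v \<in> V" for e v
        using zU[OF that(1) H_closed[OF h that(2)]] z_central[OF that(1)] h by (simp add: central_def)
      then have "U \<subseteq> {u. h u \<in> U}"
        using module_hom.subspace_linear_preimage[OF H_hom[OF h] sU]
        by (subst (1) U_def, intro span_minimal) blast+
      then show ?thesis using u by blast
    qed
    then show ?thesis using sU by (simp add: invariant_def)
  qed
  have simple: "z e a \<in> W"
    if "maximal_invariant A W" "invariant A" "A \<subseteq> V" "e \<in> I" "a \<in> A" for e a A W
    by (rule central_commutator_simple[OF xH[OF that(4) m] yH[OF that(4) m] z_central[OF that(4)] _ that(2,3,1,5)])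
       (use xy[OF that(4) m m] in simp)
  obtain T where T: "generates T" and min: "\<forall>T'. generates T' \<longrightarrow> card T \<le> card T'"
    using minimal_generators .
  have fT: "finite T" and TV: "T \<subseteq> V" using T by (auto simp: generates_def)
  have "card I \<le> card T * dim U"
  proof (rule ccontr)
    assume big: "\<not> ?thesis"
    obtain B where B: "finite B" "span B = U" "card B = dim U" using finite_basis[OF sU UV] by auto
    have "z e t \<in> span B" if "e \<in> I" "t \<in> T" for e t using zU that TV B(2) by auto
    then obtain c where c: "\<exists>e\<in>I. c e \<noteq> 0" "\<forall>t\<in>T. (\<Sum>e\<in>I. c e *s z e t) = 0"
      using homogeneous_system[of I T B z] I fT B(1,3) big by auto
    have "central (\<lambda>v. \<Sum>e\<in>I. c e *s z e v)" by (intro central_sum z_central)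
    then have "(\<Sum>e\<in>I. c e *s z e v) = 0" if "v \<in> V" for v
      using central_zero_of_generates[OF _ T _ that] c(2) by blast
    then show False using faithful c(1) by blast
  qed
  moreover have "card T + dim U + m \<le> dim V"
  proof -
    have U0: "{0} \<subset> U"
    proof (rule ccontr)
      assume "\<not> ?thesis"
      then have "U = {0}" using subspace_0[OF sU] by auto
      then have "(\<Sum>e\<in>I. 1 *s z e v) = 0" if "v \<in> V" for v
        using zU that by (auto intro: sum.neutral)
      then have "\<forall>e\<in>I. (1 :: 'k) = 0" by (rule faithful)
      then show False using I(2) by auto
    qed
    obtain W where W: "maximal_invariant U W"
      using maximal_invariant_exists[OF invariant_0 invU U0 UV] .
    have invW: "invariant W" "W \<subset> U" using W by (auto simp: maximal_invariant_def)
    then have sW: "subspace W" by (simp add: invariant_def)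
    note simpleU = simple[OF W invU UV]
    \<comment> \<open>Central operators mapping \<open>T\<close> into \<open>W\<close> map all of \<open>V\<close> there.\<close>
    have "\<exists>e\<in>I. \<exists>v\<in>T. z e v \<notin> W"
    proof (rule ccontr)
      assume "\<not> ?thesis"
      then have *: "z e t \<in> W" if "e \<in> I" "t \<in> T" for e t using that by blast
      have "z e v \<in> W" if e: "e \<in> I" and v: "v \<in> V" for e v
      proof -
        have "invariant hull T \<subseteq> {v. z e v \<in> W}"
          using invariant_preimage[OF z_central[OF e] invW(1)] *[OF e] by (intro hull_minimal) blast+
        then show ?thesis using T v by (auto simp: generates_def)
      qed
      then have "U \<subseteq> W" unfolding U_def by (intro span_minimal sW) blast
      then show False using invW(2) by blast
    qed
    then obtain e v where e: "e \<in> I" and vT: "v \<in> T" and zv: "z e v \<notin> W" by blast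
    have v: "v \<in> V" using vT TV by blast
    have vU: "v \<notin> U" using simpleU[OF e] zv by blast
    \<comment> \<open>\<open>u - l\<close> induces an endomorphism of the simple module \<open>U / W\<close>, with \<open>z e v\<close>
      in its kernel.\<close>
    have scalar: "u a - l *s a \<in> W" if u: "u \<in> H" and l: "u v - l *s v \<in> U" and a: "a \<in> U" for u l a
    proof -
      note hu = H_hom[OF u] and hz = central_hom[OF z_central[OF e]]
      let ?K = "U \<inter> {a. u a - l *s a \<in> W}"
      have "Modules.module_hom scale scale (\<lambda>a. u a - l *s a)"
        using hu by (simp add: module_hom_iff scale_right_distrib scale_right_diff_distrib mult.commute)
      then have "subspace {a. u a - l *s a \<in> W}"
        using module_hom.subspace_linear_preimage[OF _ sW] by blast
      then have "subspace ?K" using sU by (rule subspace_inter[rotated])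
      moreover have "h a \<in> ?K" if h: "h \<in> H" and a: "a \<in> ?K" for h a
      proof -
        note hh = H_hom[OF h]
        obtain c where c: "\<And>v. u (h v) - h (u v) = (\<Sum>e\<in>I. c e *s z e v)"
          using commutator[OF u h] by blast
        have "u (h a) - l *s h a = h (u a - l *s a) + (\<Sum>e\<in>I. c e *s z e a)"
          unfolding c[symmetric] by (simp add: module_hom.diff[OF hh] module_hom.scale[OF hh])
        also have "\<dots> \<in> W"
          using a h invW(1) simpleU sW
          by (intro subspace_add subspace_sum subspace_scale) (auto simp: invariant_def)
        finally show ?thesis using a h invU by (auto simp: invariant_def)
      qed
      ultimately have "invariant ?K" by (simp only: invariant_def) blast
      moreover have "W \<subseteq> ?K"
        using invW u sW by (auto simp: invariant_def intro!: subspace_diff subspace_scale)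
      moreover have "z e v \<in> ?K"
      proof -
        have "u (z e v) - l *s z e v = z e (u v - l *s v)"
          using z_central[OF e] u by (simp add: central_def module_hom.diff[OF hz] module_hom.scale[OF hz])
        then show ?thesis using simpleU[OF e l] zU[OF e v] by simp
      qed
      ultimately have "?K = U" using W zv unfolding maximal_invariant_def by blast
      then show ?thesis using a by blast
    qed
    let ?R = "insert v U"
    have spU: "span U = U" using sU by simp
    have isotropic: "u (u' v) - u' (u v) \<in> W"
      if u: "u \<in> H" "u v \<in> span ?R" and u': "u' \<in> H" "u' v \<in> span ?R" for u u'
    proof -
      note hu = H_hom[OF u(1)] and hu' = H_hom[OF u'(1)]
      obtain l l' where l: "u v - l *s v \<in> U" "u' v - l' *s v \<in> U"
        using u(2) u'(2) unfolding span_breakdown_eq spU by blast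
      have "u (u' v) - u' (u v)
        = (u (u' v - l' *s v) - l *s (u' v - l' *s v)) - (u' (u v - l *s v) - l' *s (u v - l *s v))"
        by (simp add: module_hom.diff[OF hu] module_hom.scale[OF hu] module_hom.diff[OF hu']
            module_hom.scale[OF hu'] scale_right_diff_distrib mult.commute)
      also have "\<dots> \<in> W"
        using scalar[OF u(1) l(1) l(2)] scalar[OF u'(1) l(2) l(1)] by (rule subspace_diff[OF sW])
      finally show ?thesis .
    qed
    \<comment> \<open>A maximal set of \<open>y\<close>'s with independent values at \<open>v\<close>; it will be completed by the
      \<open>x\<close>'s with the complementary indices.\<close>
    define ind where "ind J \<longleftrightarrow> J \<subseteq> {..<m} \<and>
      (\<forall>c. (\<Sum>j\<in>J. c j *s y e j v) \<in> span ?R \<longrightarrow> (\<forall>j\<in>J. c j = 0))" for J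
    have "ind {}" by (simp add: ind_def)
    moreover have "card J < Suc m" if "ind J" for J
      using card_mono[of "{..<m}" J] that by (simp add: ind_def)
    ultimately obtain J where J: "ind J" and Jmax: "\<And>J'. ind J' \<Longrightarrow> card J' \<le> card J"
      using ex_has_greatest_nat[of ind "{}" card "Suc m"] by blast
    have Jm: "J \<subseteq> {..<m}" using J by (simp add: ind_def)
    then have fJ: "finite J" by (rule finite_subset) simp
    define hh where "hh l = (if l \<in> J then y e l else x e l)" for l
    have hhH: "hh l \<in> H" if "l < m" for l using xH yH e that by (simp add: hh_def)
    \<comment> \<open>For \<open>j\<close> outside \<open>J\<close> some combination of \<open>y\<close>'s over \<open>insert j J\<close>, with nonzero
      coefficient at \<open>j\<close>, sends \<open>v\<close> into the span; its commutator with the given relation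
      isolates the coefficient of \<open>x e j\<close>.\<close>
    have zero_outside: "b j = 0"
      if b: "(\<Sum>l<m. b l *s hh l v) \<in> span ?R" and j: "j < m" "j \<notin> J" for b j
    proof -
      have "\<not> ind (insert j J)" using Jmax[of "insert j J"] fJ j by auto
      then obtain c where c: "(\<Sum>l\<in>insert j J. c l *s y e l v) \<in> span ?R" "\<exists>l\<in>insert j J. c l \<noteq> 0"
        using Jm j by (auto simp: ind_def)
      have cj: "c j \<noteq> 0"
      proof
        assume "c j = 0"
        then have "(\<Sum>l\<in>J. c l *s y e l v) \<in> span ?R" using c(1) fJ j by simp
        then show False using J c(2) \<open>c j = 0\<close> by (auto simp: ind_def)
      qed
      let ?L = "insert j J"
      let ?u = "\<lambda>a. \<Sum>l<m. b l *s hh l a" and ?u' = "\<lambda>a. \<Sum>l\<in>?L. c l *s y e l a"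
      have L: "l < m" if "l \<in> ?L" for l using that Jm j by auto
      have uH: "?u \<in> H" by (rule H_sum) (simp_all add: hhH)
      have u'H: "?u' \<in> H" by (rule H_sum) (use fJ yH e L in auto)
      have hom: "Modules.module_hom scale scale (hh l)" if "l < m" for l
        using H_hom[OF hhH[OF that]] .
      have homy: "Modules.module_hom scale scale (y e l)" if "l \<in> ?L" for l
        using H_hom[OF yH[OF e L[OF that]]] .
      have inner: "hh l (y e l' v) - y e l' (hh l v) = (if l = j \<and> l' = j then z e v else 0)"
        if "l < m" "l' \<in> ?L" for l l'
      proof -
        have "x e l (y e l' v) = (if l = l' then z e v else 0) + y e l' (x e l v)"
          using xy[OF e that(1) L[OF that(2)], of v] by (simp only: diff_eq_eq)
        then show ?thesis using that yy[OF e that(1) L[OF that(2)], of v] j by (auto simp: hh_def)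
      qed
      have "?u (?u' v) = (\<Sum>l<m. \<Sum>l'\<in>?L. (b l * c l') *s hh l (y e l' v))"
        by (intro sum.cong refl)
           (simp add: module_hom.sum[OF hom] module_hom.scale[OF hom] scale_sum_right del: sum.insert)
      moreover have "?u' (?u v) = (\<Sum>l'\<in>?L. \<Sum>l<m. (b l * c l') *s y e l' (hh l v))"
        by (intro sum.cong refl)
           (simp add: module_hom.sum[OF homy] module_hom.scale[OF homy] scale_sum_right mult.commute
             del: sum.insert)
      moreover have "\<dots> = (\<Sum>l<m. \<Sum>l'\<in>?L. (b l * c l') *s y e l' (hh l v))" by (rule sum.swap)
      ultimately have "?u (?u' v) - ?u' (?u v)
        = (\<Sum>l<m. \<Sum>l'\<in>?L. (b l * c l') *s (hh l (y e l' v) - y e l' (hh l v)))"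
        by (simp add: sum_subtractf scale_right_diff_distrib del: sum.insert)
      also have "\<dots> = (\<Sum>l<m. \<Sum>l'\<in>?L. if l = j \<and> l' = j then (b j * c j) *s z e v else 0)"
        by (intro sum.cong refl) (simp add: inner)
      also have "\<dots> = (\<Sum>l<m. if l = j then (b j * c j) *s z e v else 0)"
      proof (intro sum.cong refl)
        fix l
        have "(\<Sum>l'\<in>?L. if l = j \<and> l' = j then (b j * c j) *s z e v else 0)
          = (\<Sum>l'\<in>?L. if l' = j then (if l = j then (b j * c j) *s z e v else 0) else 0)"
          by (intro sum.cong) auto
        also have "\<dots> = (if l = j then (b j * c j) *s z e v else 0)"
          using fJ by (subst sum.delta) auto
        finally show "(\<Sum>l'\<in>?L. if l = j \<and> l' = j then (b j * c j) *s z e v else 0)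
          = (if l = j then (b j * c j) *s z e v else 0)" .
      qed
      also have "\<dots> = (b j * c j) *s z e v" using j by simp
      finally have "(b j * c j) *s z e v \<in> W"
        using isotropic[OF uH b u'H c(1)] by simp
      then have "b j * c j = 0"
        using subspace_scale[OF sW, of "(b j * c j) *s z e v" "inverse (b j * c j)"] zv
        by (metis scale_scale left_inverse scale_one)
      then show ?thesis using cj by simp
    qed
    have indep: "\<forall>l\<in>{..<m}. b l = 0" if b: "(\<Sum>l<m. b l *s hh l v) \<in> span ?R" for b
    proof -
      note zero = zero_outside[OF b]
      have "(\<Sum>l<m. b l *s hh l v) = (\<Sum>l\<in>J. b l *s y e l v)"
        using Jm zero by (intro sum.mono_neutral_cong_right) (auto simp: hh_def)
      then have "\<forall>l\<in>J. b l = 0" using b J by (simp add: ind_def)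
      then show ?thesis using zero by auto
    qed
    let ?w = "\<lambda>l. hh l v"
    have wV: "?w ` {..<m} \<subseteq> V" using H_closed hhH v by auto
    let ?P = "span (?R \<union> ?w ` {..<m})"
    have "dim ?P = dim ?R + m"
      using dim_independent_family[of "{..<m}" ?R ?w] UV v wV indep by simp
    moreover have "dim ?R = Suc (dim U)"
      using dim_insert_new[OF UV v] vU unfolding spU by blast
    moreover have PV: "?P \<subseteq> V" using UV v wV by (intro span_minimal subspace_V) auto
    ultimately obtain F where F: "F \<subseteq> V" "finite F" "card F + Suc (dim U + m) = dim V"
      "span (?P \<union> F) = V"
      using extend_subspace[OF subspace_span PV] by (metis add_Suc)
    \<comment> \<open>\<open>F\<close> and \<open>v\<close> generate \<open>V\<close> modulo \<open>U\<close>, hence generate \<open>V\<close>: \<open>U\<close> lies in every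
      maximal invariant subspace.\<close>
    let ?G = "invariant hull (insert v F)"
    have GV: "?G \<subseteq> V" using F v invariant_V by (intro hull_minimal) auto
    have FG: "F \<subseteq> ?G" "v \<in> ?G" by (auto intro: hull_inc)
    have "V \<subseteq> ?G"
    proof (rule ccontr)
      assume "\<not> ?thesis"
      then have less: "?G \<subset> V" using GV by blast
      obtain W' where W': "maximal_invariant V W'" "?G \<subseteq> W'"
        using maximal_invariant_exists[OF invariant_hull invariant_V less subset_refl] .
      then have iW': "invariant W'" "W' \<subset> V" by (auto simp: maximal_invariant_def)
      then have sW': "subspace W'" by (simp add: invariant_def)
      have "U \<subseteq> W'"
        unfolding U_def using simple[OF W'(1) invariant_V] by (intro span_minimal sW') blast
      moreover have "?w ` {..<m} \<subseteq> W'"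
        using iW'(1) hhH FG(2) W'(2) by (auto simp: invariant_def)
      ultimately have "?P \<subseteq> W'" using FG(2) W'(2) by (intro span_minimal sW') auto
      then have "span (?P \<union> F) \<subseteq> W'" using FG(1) W'(2) by (intro span_minimal sW') auto
      then show False using F(4) iW'(2) by auto
    qed
    then have "generates (insert v F)" using F v by (simp add: generates_def)
    then have "card T \<le> card (insert v F)" using min by blast
    also have "\<dots> \<le> Suc (card F)" by (rule card_insert_le_m1) simp_all
    finally show ?thesis using F(3) by simp
  qed
  ultimately show ?thesis by blast
qed

end

section \<open>The standard representation and coordinates\<close>

lemma standard_representation:
  "faithful_representation class_ring (strict_block_upper a p :: ('k :: field, 'k mat) lie_alg)
     (module_vec TYPE('k) ((p + 1) * a)) (*\<^sub>v)"
proof -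
  let ?K = "class_ring :: 'k ring"
  let ?L = "strict_block_upper a p :: ('k, 'k mat) lie_alg"
  let ?N = "(p + 1) * a"
  let ?W = "module_vec TYPE('k) ?N"
  interpret W: vec_space "TYPE('k)" ?N .
  note L = strict_block_upper_simps
  have car: "A \<in> carrier_mat ?N ?N" if "A \<in> strict_block_upper_mats a p" for A :: "'k mat"
    using that by (simp add: strict_block_upper_mats_def)
  have "lie_representation ?K ?L ?W (*\<^sub>v)"
  proof (rule lie_representation.intro[OF strict_block_upper_lie_algebra vec_vs],
      rule lie_representation_axioms.intro, unfold L module_vec_simps class_ring_simps)
    fix x y :: "'k mat" and v :: "'k vec" and c :: 'k
    assume x: "x \<in> strict_block_upper_mats a p"
    note cx = car[OF x]
    show "(*\<^sub>v) x \<in> LinearCombinations.module_hom ?K ?W ?W"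
      using cx by (auto simp: LinearCombinations.module_hom_def module_vec_simps class_ring_simps
          mult_add_distrib_mat_vec mult_mat_vec)
    assume v: "v \<in> carrier_vec ?N"
    show "(c \<cdot>\<^sub>m x) *\<^sub>v v = c \<cdot>\<^sub>v (x *\<^sub>v v)"
      using cx v by (intro eq_vecI) auto
    assume y: "y \<in> strict_block_upper_mats a p"
    note cy = car[OF y]
    show "(x + y) *\<^sub>v v = x *\<^sub>v v + y *\<^sub>v v"
      using cx cy v by (rule add_mult_distrib_mat_vec)
    have "(x * y - y * x) *\<^sub>v v = x *\<^sub>v (y *\<^sub>v v) - y *\<^sub>v (x *\<^sub>v v)"
      using cx cy v by (simp add: minus_mult_distrib_mat_vec[of _ ?N ?N])
    moreover have "u - w = u \<ominus>\<^bsub>?W\<^esub> w" if "u \<in> carrier_vec ?N" "w \<in> carrier_vec ?N" for u w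
      unfolding a_minus_def W.vec_neg[OF that(2)] module_vec_simps using that by auto
    ultimately show "(x * y - y * x) *\<^sub>v v = x *\<^sub>v (y *\<^sub>v v) \<ominus>\<^bsub>?W\<^esub> y *\<^sub>v (x *\<^sub>v v)"
      using cx cy v by simp
  qed
  then show ?thesis
  proof (rule faithful_representation.intro, intro faithful_representation_axioms.intro,
      unfold L module_vec_simps)
    fix x y :: "'k mat"
    assume x: "x \<in> strict_block_upper_mats a p" and y: "y \<in> strict_block_upper_mats a p"
      and eq: "\<And>v. v \<in> carrier_vec ?N \<Longrightarrow> x *\<^sub>v v = y *\<^sub>v v"
    note cx = car[OF x] and cy = car[OF y]
    show "x = y"
    proof (rule eq_matI)
      fix i j assume "i < dim_row y" "j < dim_col y"
      then have ij: "i < ?N" "j < ?N" using cy by auto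
      have "(x *\<^sub>v unit_vec ?N j) $ i = (y *\<^sub>v unit_vec ?N j) $ i" by (simp add: eq)
      then show "x $$ (i, j) = y $$ (i, j)" using ij cx cy by simp
    qed (use cx cy in auto)
  qed
qed

text \<open>
  Coordinate sequences form a type of class \<open>ab_group_add\<close>, so a space given
  by a carrier set can be studied through linear operators that are total on the type. The map
  \<open>\<psi>\<close> is total and linear on all sequences: it ignores the entries beyond the dimension.
\<close>

lemma coordinates:
  fixes V :: "('k :: field, 'v) module"
  assumes vs: "vectorspace class_ring V" and fin: "vectorspace.fin_dim class_ring V"
  obtains \<phi> :: "'v \<Rightarrow> nat \<Rightarrow> 'k" and \<psi> :: "(nat \<Rightarrow> 'k) \<Rightarrow> 'v" where
    "\<forall>f. \<psi> f \<in> carrier V"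
    "\<forall>f g. \<psi> (\<lambda>i. f i + g i) = \<psi> f \<oplus>\<^bsub>V\<^esub> \<psi> g"
    "\<forall>c f. \<psi> (\<lambda>i. c * f i) = c \<odot>\<^bsub>V\<^esub> \<psi> f"
    "\<forall>v \<in> carrier V. \<psi> (\<phi> v) = v"
    "\<forall>u \<in> carrier V. \<forall>v \<in> carrier V. \<phi> (u \<oplus>\<^bsub>V\<^esub> v) = (\<lambda>i. \<phi> u i + \<phi> v i)"
    "\<forall>c. \<forall>v \<in> carrier V. \<phi> (c \<odot>\<^bsub>V\<^esub> v) = (\<lambda>i. c * \<phi> v i)"
    "\<forall>v \<in> carrier V. \<forall>i \<ge> vectorspace.dim class_ring V. \<phi> v i = 0"
proof -
  interpret V: vectorspace class_ring V by (rule vs)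
  let ?K = "class_ring :: 'k ring"
  obtain B where finB: "finite B" and basB: "V.basis B"
    using V.finite_basis_exists[OF fin] by blast
  have BV: "B \<subseteq> carrier V" using basB by (simp add: V.basis_def)
  let ?d = "V.dim"
  have d: "?d = card B" using V.dim_basis[OF finB basB] .
  obtain idx where idx: "bij_betw idx B {0..<?d}"
    using ex_bij_betw_finite_nat[OF finB] d by metis
  define crd :: "(nat \<Rightarrow> 'k) \<Rightarrow> 'v \<Rightarrow> 'k" where "crd f = restrict (\<lambda>b. f (idx b)) B" for f
  define \<psi> where "\<psi> f = V.lincomb (crd f) B" for f
  have "linear_map ?K (class_ring.func_space B) V (\<lambda>c. V.lincomb c B)"
    using V.lincomb_is_linear[OF finB BV] by simp
  then have linh: "(\<lambda>c. V.lincomb c B) \<in> LinearCombinations.module_hom ?K (class_ring.func_space B) V"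
    by (simp add: linear_map_def mod_hom_def mod_hom_axioms_def)
  have cc: "crd f \<in> B \<rightarrow>\<^sub>E UNIV" for f by (simp add: crd_def)
  have psi_c: "\<psi> f \<in> carrier V" for f
    using LinearCombinations.module_hom_closed[OF linh] cc[of f]
    by (auto simp: \<psi>_def class_ring.func_space_def class_ring_simps)
  have psi_add: "\<psi> (\<lambda>i. f i + g i) = \<psi> f \<oplus>\<^bsub>V\<^esub> \<psi> g" for f g
  proof -
    have "crd (\<lambda>i. f i + g i) = crd f \<oplus>\<^bsub>class_ring.func_space B\<^esub> crd g"
      by (auto simp: crd_def class_ring.func_space_def class_ring_simps fun_eq_iff)
    then show ?thesis using LinearCombinations.module_hom_add[OF linh] cc[of f] cc[of g]
      by (simp add: \<psi>_def class_ring.func_space_def class_ring_simps)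
  qed
  have psi_smult: "\<psi> (\<lambda>i. c * f i) = c \<odot>\<^bsub>V\<^esub> \<psi> f" for c f
  proof -
    have "crd (\<lambda>i. c * f i) = c \<odot>\<^bsub>class_ring.func_space B\<^esub> crd f"
      by (auto simp: crd_def class_ring.func_space_def class_ring_simps fun_eq_iff)
    then show ?thesis using LinearCombinations.module_hom_smult[OF linh] cc[of f]
      by (simp add: \<psi>_def class_ring.func_space_def class_ring_simps)
  qed
  have uniq: "\<exists>!c. c \<in> B \<rightarrow>\<^sub>E UNIV \<and> V.lincomb c B = v" if "v \<in> carrier V" for v
    using V.basis_criterion[OF finB BV] basB that by (simp add: class_ring_simps)
  let ?S = "\<lambda>f :: nat \<Rightarrow> 'k. \<forall>i \<ge> ?d. f i = 0"
  have psi_inj: "f = g" if eq: "\<psi> f = \<psi> g" and S: "?S f" "?S g" for f g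
  proof
    fix i
    have crd: "crd f = crd g"
      using uniq[OF psi_c[of f]] cc[of f] cc[of g] eq unfolding \<psi>_def by metis
    show "f i = g i"
    proof (cases "i < ?d")
      case True
      then have "i \<in> idx ` B" using idx by (auto simp: bij_betw_def)
      then obtain b where "b \<in> B" "i = idx b" by blast
      then show ?thesis using fun_cong[OF crd, of b] by (simp add: crd_def)
    next
      case False
      then show ?thesis using S by simp
    qed
  qed
  have psi_surj: "\<exists>f. ?S f \<and> \<psi> f = v" if "v \<in> carrier V" for v
  proof -
    obtain c where c: "c \<in> B \<rightarrow>\<^sub>E UNIV" "V.lincomb c B = v" using uniq \<open>v \<in> carrier V\<close> by blast
    let ?f = "\<lambda>i. if i < ?d then c (inv_into B idx i) else 0"
    have "crd ?f = c"
    proof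
      fix b show "crd ?f b = c b"
        using c(1) idx by (auto simp: crd_def bij_betw_def PiE_def extensional_def)
    qed
    then show ?thesis using c(2) by (intro exI[of _ ?f]) (auto simp: \<psi>_def)
  qed
  define \<phi> where "\<phi> v = (SOME f. ?S f \<and> \<psi> f = v)" for v
  have phi: "?S (\<phi> v)" "\<psi> (\<phi> v) = v" if "v \<in> carrier V" for v
    using someI_ex[OF psi_surj[OF that]] unfolding \<phi>_def by blast+
  have phi_psi: "\<phi> (\<psi> f) = f" if "?S f" for f
    using psi_inj[OF phi(2)[OF psi_c] phi(1)[OF psi_c] that] .
  have phi_add: "\<phi> (u \<oplus>\<^bsub>V\<^esub> v) = (\<lambda>i. \<phi> u i + \<phi> v i)" if "u \<in> carrier V" "v \<in> carrier V" for u v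
    using phi_psi[of "\<lambda>i. \<phi> u i + \<phi> v i"] phi[OF that(1)] phi[OF that(2)] by (simp add: psi_add)
  have phi_smult: "\<phi> (c \<odot>\<^bsub>V\<^esub> v) = (\<lambda>i. c * \<phi> v i)" if "v \<in> carrier V" for c v
    using phi_psi[of "\<lambda>i. c * \<phi> v i"] phi[OF that] by (simp add: psi_smult)
  show thesis
    by (rule that[of \<psi> \<phi>]) (use psi_c psi_add psi_smult phi phi_add phi_smult in auto)
qed

section \<open>Matrices with prescribed support\<close>

definition supported :: "nat \<Rightarrow> (nat \<Rightarrow> nat \<Rightarrow> bool) \<Rightarrow> 'k :: zero mat set" where
  "supported N Q = {A \<in> carrier_mat N N. \<forall>r<N. \<forall>c<N. \<not> Q r c \<longrightarrow> A $$ (r, c) = 0}"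

definition matrix_unit :: "nat \<Rightarrow> nat \<Rightarrow> nat \<Rightarrow> 'k :: {zero, one} mat" where
  "matrix_unit N r c = mat N N (\<lambda>(i, j). if i = r \<and> j = c then 1 else 0)"

lemma matrix_unit_carrier [simp]: "matrix_unit N r c \<in> carrier_mat N N"
  by (simp add: matrix_unit_def)

lemma supported_carrier: "A \<in> supported N Q \<Longrightarrow> A \<in> carrier_mat N N"
  by (simp add: supported_def)

lemma supportedD: "A \<in> supported N Q \<Longrightarrow> r < N \<Longrightarrow> c < N \<Longrightarrow> \<not> Q r c \<Longrightarrow> A $$ (r, c) = 0"
  by (simp add: supported_def)

lemma matrix_unit_supported: "Q r c \<Longrightarrow> matrix_unit N r c \<in> supported N Q"
  by (auto simp: supported_def matrix_unit_def)

lemma matrix_unit_mult: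
  assumes "s < N"
  shows "matrix_unit N r s * matrix_unit N s' c
    = (if s = s' then matrix_unit N r c else 0\<^sub>m N N :: 'k :: semiring_1 mat)"
proof (rule eq_matI)
  fix i j assume "i < dim_row (if s = s' then matrix_unit N r c else 0\<^sub>m N N :: 'k mat)"
    "j < dim_col (if s = s' then matrix_unit N r c else 0\<^sub>m N N :: 'k mat)"
  then have ij: "i < N" "j < N" by (auto simp: matrix_unit_def split: if_splits)
  have "(matrix_unit N r s * matrix_unit N s' c :: 'k mat) $$ (i, j)
    = (\<Sum>l = 0..<N. (if i = r \<and> l = s then 1 else 0) * (if l = s' \<and> j = c then 1 else 0))"
    using ij by (simp add: matrix_unit_def scalar_prod_def)
  also have "\<dots> = (\<Sum>l = 0..<N. if l = s then (if i = r \<and> s = s' \<and> j = c then 1 else 0) else 0)"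
    by (intro sum.cong) auto
  also have "\<dots> = (if i = r \<and> s = s' \<and> j = c then 1 else 0)" using assms by simp
  finally show "(matrix_unit N r s * matrix_unit N s' c :: 'k mat) $$ (i, j)
    = (if s = s' then matrix_unit N r c else 0\<^sub>m N N) $$ (i, j)"
    using ij by (auto simp: matrix_unit_def)
qed (auto simp: matrix_unit_def)

lemma supported_mult:
  fixes A B :: "'k :: semiring_0 mat"
  assumes A: "A \<in> supported N Q" and B: "B \<in> supported N Q'"
    and Q: "\<And>r l c. Q r l \<Longrightarrow> Q' l c \<Longrightarrow> Q'' r c"
  shows "A * B \<in> supported N Q''"
proof -
  note cA = supported_carrier[OF A] and cB = supported_carrier[OF B]
  have "(A * B) $$ (r, c) = 0" if rc: "r < N" "c < N" "\<not> Q'' r c" for r c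
  proof -
    have "A $$ (r, l) * B $$ (l, c) = 0" if l: "l < N" for l
    proof -
      have "A $$ (r, l) = 0 \<or> B $$ (l, c) = 0"
        using supportedD[OF A rc(1) l] supportedD[OF B l rc(2)] Q[of r l c] rc(3) by blast
      then show ?thesis by auto
    qed
    then have "(\<Sum>l = 0..<N. A $$ (r, l) * B $$ (l, c)) = 0" by (intro sum.neutral) auto
    then show ?thesis using cA cB rc by (auto simp: scalar_prod_def)
  qed
  then show ?thesis using cA cB by (auto simp: supported_def)
qed

lemma supported_False: "A \<in> supported N (\<lambda>_ _. False) \<Longrightarrow> A = 0\<^sub>m N N"
  by (auto simp: supported_def)

lemma supported_minus:
  fixes A B :: "'k :: group_add mat"
  assumes "A \<in> supported N Q" "B \<in> supported N Q"
  shows "A - B \<in> supported N Q"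
  using assms by (auto simp: supported_def)

lemma supported_add:
  fixes A B :: "'k :: monoid_add mat"
  assumes "A \<in> supported N Q" "B \<in> supported N Q"
  shows "A + B \<in> supported N Q"
  using assms by (auto simp: supported_def)

lemma supported_smult:
  fixes A :: "'k :: mult_zero mat"
  assumes "A \<in> supported N Q"
  shows "c \<cdot>\<^sub>m A \<in> supported N Q"
  using assms by (auto simp: supported_def)

lemma supported_mono:
  assumes "A \<in> supported N Q" "\<And>r c. Q r c \<Longrightarrow> Q' r c"
  shows "A \<in> supported N Q'"
  using assms by (auto simp: supported_def)

section \<open>The minimal dimension\<close>

lemma twice_le_add_of_square_le_mult:
  fixes a s t :: nat
  assumes "a * a \<le> s * t" shows "2 * a \<le> s + t"
proof (rule ccontr)
  assume "\<not> ?thesis"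
  then have "s + t < 2 * a" by simp
  then have "int (s + t) ^ 2 < int (2 * a) ^ 2" by (intro power_strict_mono) auto
  moreover have "int (s + t) ^ 2 = 4 * int (s * t) + (int s - int t) ^ 2"
    by (simp add: power2_eq_square algebra_simps)
  moreover have "int (a * a) \<le> int (s * t)" using assms by (simp only: of_nat_le_iff)
  ultimately show False using zero_le_power2[of "int s - int t"]
    by (simp add: power2_eq_square algebra_simps)
qed

text \<open>
  The condition \<open>a \<ge> 2\<close> enters only here: for \<open>a = 1\<close> the values \<open>n = s = 1\<close>
  satisfy the inequality.
\<close>

lemma schur_jacobson_arith:
  fixes a s n :: nat
  assumes "a \<ge> 2" "s \<le> n" "a * a \<le> s * (n - s) + 1"
  shows "2 * a \<le> n"
proof (rule ccontr)
  assume "\<not> ?thesis"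
  then have small: "s + (n - s) \<le> 2 * a - 1" using assms by simp
  define t where "t = n - s"
  obtain b where b: "a = b + 2" using assms(1) by (metis add.commute le_Suc_ex)
  have "int (s + t) ^ 2 \<le> int (2 * b + 3) ^ 2"
    using small b by (intro power_mono) (auto simp: t_def)
  moreover have "int (s + t) ^ 2 = 4 * int (s * t) + (int s - int t) ^ 2"
    by (simp add: power2_eq_square algebra_simps)
  moreover have "int (a * a) \<le> int (s * t + 1)" using assms(3) unfolding t_def by (simp only: of_nat_le_iff)
  ultimately show False using zero_le_power2[of "int s - int t"]
    by (simp add: power2_eq_square algebra_simps b)
qed

text \<open>
  The matrices supported on \<open>QH\<close> are those of the regrouped block pattern \<open>a, m, a\<close>, and
  \<open>QZ\<close> describes its corner. Conjugating the representation by coordinates turns the corresponding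
  operators into maps on sequences; the matrix units in the corner are indexed by their positions,
  and the unit at \<open>(r, c)\<close> is the commutator of the units at \<open>(r, a + j)\<close> and
  \<open>(a + j, c)\<close> for every \<open>j < m\<close>.
\<close>

lemma strict_block_upper_lower_bound:
  fixes V :: "('k :: field_char_0, 'v) module"
  assumes faith: "faithful_representation class_ring (strict_block_upper a p :: ('k, 'k mat) lie_alg) V rep"
    and fin: "vectorspace.fin_dim class_ring V"
    and a: "a \<ge> 1" and p: "p \<ge> 1" and ap: "(a, p) \<noteq> (1, 1)"
  shows "(p + 1) * a \<le> vectorspace.dim class_ring V"
proof -
  let ?K = "class_ring :: 'k ring"
  let ?L = "strict_block_upper a p :: ('k, 'k mat) lie_alg"
  interpret V: vectorspace ?K V
    using faith by (simp add: faithful_representation_def lie_representation_def)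
  interpret R: faithful_representation ?K ?L V rep by (rule faith)
  let ?d = "vectorspace.dim class_ring V"
  obtain \<phi> :: "'v \<Rightarrow> nat \<Rightarrow> 'k" and \<psi> :: "(nat \<Rightarrow> 'k) \<Rightarrow> 'v" where
    coords: "\<forall>f. \<psi> f \<in> carrier V"
    "\<forall>f g. \<psi> (\<lambda>i. f i + g i) = \<psi> f \<oplus>\<^bsub>V\<^esub> \<psi> g"
    "\<forall>c f. \<psi> (\<lambda>i. c * f i) = c \<odot>\<^bsub>V\<^esub> \<psi> f"
    "\<forall>v \<in> carrier V. \<psi> (\<phi> v) = v"
    "\<forall>u \<in> carrier V. \<forall>v \<in> carrier V. \<phi> (u \<oplus>\<^bsub>V\<^esub> v) = (\<lambda>i. \<phi> u i + \<phi> v i)"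
    "\<forall>c. \<forall>v \<in> carrier V. \<phi> (c \<odot>\<^bsub>V\<^esub> v) = (\<lambda>i. c * \<phi> v i)"
    "\<forall>v \<in> carrier V. \<forall>i \<ge> ?d. \<phi> v i = 0"
    using coordinates[OF V.vectorspace_axioms fin] .
  note psi_c = coords(1)[rule_format] and psi_add = coords(2)[rule_format]
    and psi_smult = coords(3)[rule_format] and psi_phi = coords(4)[rule_format]
    and phi_add = coords(5)[rule_format] and phi_smult = coords(6)[rule_format]
    and phi_zero = coords(7)[rule_format]
  let ?S = "strict_block_upper_mats a p :: 'k mat set"
  note L = strict_block_upper_simps
  define op where "op A f = \<phi> (rep A (\<psi> f))" for A and f :: "nat \<Rightarrow> 'k"
  have rep_hom: "rep A \<in> LinearCombinations.module_hom ?K V V" if "A \<in> ?S" for A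
    using R.rep_linear[of A] that by (simp add: L)
  have rep_c: "rep A v \<in> carrier V" if "A \<in> ?S" "v \<in> carrier V" for A v
    using LinearCombinations.module_hom_closed[OF rep_hom[OF that(1)]] that(2) by blast
  have op_add_right: "op A (\<lambda>i. f i + g i) = (\<lambda>i. op A f i + op A g i)" if "A \<in> ?S" for A f g
    using LinearCombinations.module_hom_add[OF rep_hom[OF that], of "\<psi> f" "\<psi> g"] that
    by (simp add: op_def psi_add psi_c rep_c phi_add L)
  have op_smult_right: "op A (\<lambda>i. c * f i) = (\<lambda>i. c * op A f i)" if "A \<in> ?S" for A f c
    using LinearCombinations.module_hom_smult[OF rep_hom[OF that], of c "\<psi> f"] that
    by (simp add: op_def psi_smult psi_c rep_c phi_smult L class_ring_simps)
  have op_add: "op (A + B) f i = op A f i + op B f i" if "A \<in> ?S" "B \<in> ?S" for A B f i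
    using R.rep_add[of A B "\<psi> f"] that by (simp add: op_def L psi_c rep_c phi_add)
  have op_smult: "op (c \<cdot>\<^sub>m A) f i = c * op A f i" if "A \<in> ?S" for A f c i
    using R.rep_smult[of c A "\<psi> f"] that
    by (simp add: op_def L psi_c rep_c phi_smult class_ring_simps)
  have phi_minus: "\<phi> (u \<ominus>\<^bsub>V\<^esub> v) i = \<phi> u i - \<phi> v i" if "u \<in> carrier V" "v \<in> carrier V" for u v i
  proof -
    have "u = (u \<ominus>\<^bsub>V\<^esub> v) \<oplus>\<^bsub>V\<^esub> v"
      using that by (simp add: a_minus_def V.a_assoc V.l_neg)
    then have "\<phi> u i = \<phi> (u \<ominus>\<^bsub>V\<^esub> v) i + \<phi> v i"
      using phi_add[of "u \<ominus>\<^bsub>V\<^esub> v" v] that V.minus_closed by metis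
    then show ?thesis by simp
  qed
  have op_comm: "op A (op B f) i - op B (op A f) i = op (A * B - B * A) f i"
    if "A \<in> ?S" "B \<in> ?S" for A B f i
    using R.rep_bracket[of A B "\<psi> f"] that
    by (simp add: op_def L psi_c rep_c phi_minus psi_phi)

  define m where "m = (p - 1) * a"
  define N where "N = 2 * a + m"
  have N: "N = (p + 1) * a" using p by (cases p) (simp_all add: N_def m_def)
  have am: "a + m = p * a" using p by (cases p) (simp_all add: m_def)
  define QH where "QH r c \<longleftrightarrow> (r < a \<and> a \<le> c) \<or> (r < a + m \<and> a + m \<le> c)" for r c
  define QZ where "QZ r c \<longleftrightarrow> r < a \<and> a + m \<le> c" for r c
  have ZH: "QH r c" if "QZ r c" for r c using that by (auto simp: QH_def QZ_def)
  have a0: "a > 0" using a by simp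
  have sub: "A \<in> ?S" if A: "A \<in> supported N QH" for A
  proof -
    have less: "r div a < c div a" if "QH r c" for r c
    proof -
      have "r < q * a \<Longrightarrow> q * a \<le> c \<Longrightarrow> r div a < c div a" for q
        using a by (metis div_le_mono le_less_trans less_le_trans less_mult_imp_div_less
            nonzero_mult_div_cancel_right not_one_le_zero)
      from this[of 1] this[of p] show ?thesis using that unfolding QH_def am by auto
    qed
    show ?thesis
      unfolding strict_block_upper_mats_iff[OF a0] N[symmetric]
    proof (intro conjI allI impI)
      show "A \<in> carrier_mat N N" by (rule supported_carrier[OF A])
      fix r c assume rc: "r < N" "c < N" "c div a \<le> r div a"
      have "\<not> QH r c" using less[of r c] rc(3) by linarith
      then show "A $$ (r, c) = 0" by (rule supportedD[OF A rc(1,2)])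
    qed
  qed
  let ?MH = "supported N QH :: 'k mat set" and ?MZ = "supported N QZ :: 'k mat set"
  have MZH: "A \<in> ?MH" if "A \<in> ?MZ" for A using that ZH by (rule supported_mono)
  have comm: "A * B - B * A \<in> ?MZ" if "A \<in> ?MH" "B \<in> ?MH" for A B
    using that by (intro supported_minus supported_mult[of _ N QH _ QH QZ]) (auto simp: QH_def QZ_def)
  have comm0: "A * B - B * A = 0\<^sub>m N N" if "A \<in> ?MZ" "B \<in> ?MH" for A B
    using that by (intro supported_False supported_minus supported_mult[of _ N QZ _ QH]
        supported_mult[of _ N QH _ QZ]) (auto simp: QH_def QZ_def)
  have zero_MZ: "0\<^sub>m N N \<in> ?MZ" by (simp add: supported_def)
  have op_zero: "op (0\<^sub>m N N) f i = 0" for f i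
  proof -
    have "op (0\<^sub>m N N + 0\<^sub>m N N) f i = op (0\<^sub>m N N) f i + op (0\<^sub>m N N) f i"
      by (intro op_add sub MZH zero_MZ)
    then show ?thesis by simp
  qed

  let ?E = "\<lambda>e. matrix_unit N (fst e) (snd e) :: 'k mat"
  let ?I = "{..<a} \<times> {a + m..<N}"
  have IZ: "?E e \<in> ?MZ" if "e \<in> ?I" for e
    by (rule matrix_unit_supported) (use that in \<open>auto simp: QZ_def\<close>)
  \<comment> \<open>Expansion of a corner matrix in matrix units, carried through the representation.\<close>
  have combination: "mat N N (\<lambda>e. if e \<in> J then g e else 0) \<in> ?MZ \<and>
      op (mat N N (\<lambda>e. if e \<in> J then g e else 0)) f i = (\<Sum>e\<in>J. g e * op (?E e) f i)"
    if "finite J" "J \<subseteq> ?I" for J g f i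
    using that
  proof (induction J rule: finite_induct)
    case empty
    have "mat N N (\<lambda>e. if e \<in> {} then g e else 0) = 0\<^sub>m N N" by auto
    then show ?case using zero_MZ op_zero by simp
  next
    case (insert e J)
    let ?M = "\<lambda>J. mat N N (\<lambda>e. if e \<in> J then g e else 0)"
    have split: "?M (insert e J) = g e \<cdot>\<^sub>m ?E e + ?M J"
      using insert(2) by (intro eq_matI) (auto simp: matrix_unit_def)
    have e: "?E e \<in> ?MZ" using insert IZ by blast
    have J: "?M J \<in> ?MZ" "op (?M J) f i = (\<Sum>e\<in>J. g e * op (?E e) f i)"
      using insert by auto
    have "g e \<cdot>\<^sub>m ?E e + ?M J \<in> ?MZ" using e J(1) by (intro supported_add supported_smult)
    moreover have "op (g e \<cdot>\<^sub>m ?E e + ?M J) f i = g e * op (?E e) f i + op (?M J) f i"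
      using e J(1) by (simp add: op_add op_smult sub MZH supported_smult)
    ultimately show ?case unfolding split J(2) using insert(1,2) by simp
  qed
  have finI: "finite ?I" by simp
  have "(0, a + m) \<in> ?I" using a0 by (simp add: N_def)
  then have I_nonempty: "?I \<noteq> {}" by blast

  let ?V = "{f :: nat \<Rightarrow> 'k. \<forall>i \<ge> ?d. f i = 0}"
  let ?H = "op ` ?MH"
  interpret F: vector_space "\<lambda>c (f :: nat \<Rightarrow> 'k) i. c * f i"
    by unfold_locales (auto simp: fun_eq_iff algebra_simps)
  have sum_fun: "sum f A x = (\<Sum>a\<in>A. f a x)" for f :: "'e \<Rightarrow> nat \<Rightarrow> 'k" and A x
    by (induction A rule: infinite_finite_induct) auto
  let ?B = "(\<lambda>j i. if i = j then 1 else 0 :: 'k) ` {..<?d}"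
  have VB: "?V \<subseteq> F.span ?B"
  proof
    fix f assume f: "f \<in> ?V"
    have "f = (\<Sum>j<?d. (\<lambda>i. f j * (if i = j then 1 else 0)))"
    proof
      fix i
      have "(\<Sum>j<?d. f j * (if i = j then 1 else 0)) = (\<Sum>j<?d. if i = j then f i else 0)"
        by (intro sum.cong) auto
      then show "f i = (\<Sum>j<?d. (\<lambda>i. f j * (if i = j then 1 else 0))) i"
        using f by (simp add: sum_fun)
    qed
    also have "\<dots> \<in> F.span ?B" by (intro F.span_sum F.span_scale F.span_base) auto
    finally show "f \<in> F.span ?B" .
  qed
  have dimV: "F.dim ?V \<le> ?d"
  proof -
    have "F.dim ?V \<le> card ?B" by (rule F.dim_le_card[OF VB]) simp
    also have "\<dots> \<le> card {..<?d}" by (rule card_image_le) simp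
    finally show ?thesis by simp
  qed
  interpret O: operator_space_char_0 "\<lambda>c (f :: nat \<Rightarrow> 'k) i. c * f i" ?V ?H
  proof (intro operator_space_char_0.intro operator_space.intro fd_subspace.intro
      fd_subspace_axioms.intro operator_space_axioms.intro F.vector_space_axioms)
    show "F.subspace ?V" by (rule F.subspaceI) auto
    show "\<exists>B. finite B \<and> ?V \<subseteq> F.span B" using VB by (intro exI[of _ ?B]) simp
    show "Vector_Spaces.linear (\<lambda>c (f :: nat \<Rightarrow> 'k) i. c * f i) (\<lambda>c f i. c * f i) h" if "h \<in> ?H" for h
      unfolding Vector_Spaces.linear_iff
      using that sub op_add_right op_smult_right F.vector_space_axioms by (auto simp: plus_fun_def)
    show "h v \<in> ?V" if "h \<in> ?H" "v \<in> ?V" for h v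
      using that sub psi_c rep_c phi_zero by (auto simp: op_def)
  qed
  let ?z = "\<lambda>e. op (?E e)"
  have zH: "?z e \<in> ?H" if "e \<in> ?I" for e using IZ[OF that] MZH by blast
  have z_central: "O.central (?z e)" if "e \<in> ?I" for e
  proof -
    have "op (?E e) (op A f) = op A (op (?E e) f)" if A: "A \<in> ?MH" for A f
    proof
      fix i show "op (?E e) (op A f) i = op A (op (?E e) f) i"
        using op_comm[of "?E e" A f i] comm0[OF IZ[OF \<open>e \<in> ?I\<close>] A] op_zero[of f i]
          sub[OF A] sub[OF MZH[OF IZ[OF \<open>e \<in> ?I\<close>]]] by simp
    qed
    then show ?thesis using O.H_linear[OF zH[OF that]] by (auto simp: O.central_def)
  qed
  have faithful: "\<forall>e\<in>?I. c e = 0"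
    if "\<And>f. f \<in> ?V \<Longrightarrow> (\<Sum>e\<in>?I. (\<lambda>i. c e * ?z e f i)) = 0" for c
  proof -
    let ?C = "mat N N (\<lambda>e. if e \<in> ?I then c e else 0)"
    note C = combination[of ?I c, OF finI subset_refl]
    have zero: "op ?C f = 0" if "f \<in> ?V" for f
    proof
      fix i
      have "op ?C f i = (\<Sum>e\<in>?I. (\<lambda>i. c e * ?z e f i)) i"
        unfolding sum_fun using C by blast
      then show "op ?C f i = 0 i" using \<open>f \<in> ?V \<Longrightarrow> (\<Sum>e\<in>?I. (\<lambda>i. c e * ?z e f i)) = 0\<close>[OF that]
        by simp
    qed
    have CS: "?C \<in> ?S" "0\<^sub>m N N \<in> ?S" using C zero_MZ MZH sub by blast+
    have "?C = 0\<^sub>m N N"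
    proof (rule R.faithful)
      fix v assume v: "v \<in> carrier V"
      have "\<phi> v \<in> ?V" using phi_zero v by blast
      then have "\<phi> (rep ?C v) = \<phi> (rep (0\<^sub>m N N) v)"
        using zero[of "\<phi> v"] op_zero[of "\<phi> v"] by (auto simp: op_def psi_phi[OF v])
      then show "rep ?C v = rep (0\<^sub>m N N) v"
        using psi_phi rep_c CS v by metis
    qed (use CS in \<open>simp_all add: L\<close>)
    show ?thesis
    proof
      fix e assume e: "e \<in> ?I"
      then have "e \<in> {..<N} \<times> {..<N}" by (auto simp: N_def)
      then have "?C $$ e = c e" using e by (cases e) auto
      then show "c e = 0" using \<open>?C = 0\<^sub>m N N\<close> \<open>e \<in> {..<N} \<times> {..<N}\<close> by (cases e) auto
    qed
  qed
  have cardI: "card ?I = a * a" by (simp add: card_cartesian_product N_def)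
  have "N \<le> F.dim ?V"
  proof (cases "p = 1")
    case True
    then have m0: "m = 0" and a2: "a \<ge> 2" using a ap by (auto simp: m_def)
    have "\<exists>s \<le> F.dim ?V. card ?I \<le> s * (F.dim ?V - s) + 1"
      by (rule O.schur_jacobson_bound[where z = ?z, OF finI zH z_central faithful])
    then obtain s where "s \<le> F.dim ?V" "a * a \<le> s * (F.dim ?V - s) + 1"
      unfolding cardI by blast
    then show ?thesis using schur_jacobson_arith a2 by (simp add: N_def m0)
  next
    case False
    then have m: "m > 0" using p a by (simp add: m_def)
    have "\<exists>s t. card ?I \<le> s * t \<and> s + t + m \<le> F.dim ?V"
    proof (rule O.heisenberg_bound[where z = ?z and m = m
          and x = "\<lambda>e j. op (matrix_unit N (fst e) (a + j))"
          and y = "\<lambda>e j. op (matrix_unit N (a + j) (snd e))"])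
      fix e j assume e: "e \<in> ?I" and j: "j < m"
      show "op (matrix_unit N (fst e) (a + j)) \<in> ?H"
        by (intro imageI matrix_unit_supported) (use e j in \<open>auto simp: QH_def\<close>)
      show "op (matrix_unit N (a + j) (snd e)) \<in> ?H"
        by (intro imageI matrix_unit_supported) (use e j in \<open>auto simp: QH_def\<close>)
    next
      fix e j l f assume e: "e \<in> ?I" and j: "j < m" and l: "l < m"
      let ?X = "\<lambda>j. matrix_unit N (fst e) (a + j) :: 'k mat" and ?Y = "\<lambda>j. matrix_unit N (a + j) (snd e) :: 'k mat"
      have X: "?X j \<in> ?MH" if "j < m" for j
        by (intro matrix_unit_supported) (use e that in \<open>auto simp: QH_def\<close>)
      have Y: "?Y j \<in> ?MH" if "j < m" for j
        by (intro matrix_unit_supported) (use e that in \<open>auto simp: QH_def\<close>)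
      have lt: "a + j < N" "snd e < N" and ne: "snd e \<noteq> fst e" "snd e \<noteq> a + j" "snd e \<noteq> a + l"
        using e j l by (auto simp: N_def)
      have "?E e - 0\<^sub>m N N = ?E e" by (rule eq_matI) (auto simp: matrix_unit_def)
      then have "?X j * ?Y l - ?Y l * ?X j = (if j = l then ?E e else 0\<^sub>m N N)"
        using lt ne by (auto simp: matrix_unit_mult)
      then have "op (?X j) (op (?Y l) f) i - op (?Y l) (op (?X j) f) i = (if j = l then ?z e f else 0) i" for i
        using op_comm[OF sub[OF X[OF j]] sub[OF Y[OF l]], of f i] op_zero[of f i] by simp
      then show "op (?X j) (op (?Y l) f) - op (?Y l) (op (?X j) f) = (if j = l then ?z e f else 0)"
        by (auto simp: fun_eq_iff)
      have "?Y j * ?Y l - ?Y l * ?Y j = 0\<^sub>m N N"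
        using lt ne by (auto simp: matrix_unit_mult)
      then have "op (?Y j) (op (?Y l) f) i = op (?Y l) (op (?Y j) f) i" for i
        using op_comm[OF sub[OF Y[OF j]] sub[OF Y[OF l]], of f i] op_zero[of f i] by simp
      then show "op (?Y j) (op (?Y l) f) = op (?Y l) (op (?Y j) f)" by (rule ext)
    next
      fix f g assume "f \<in> ?H" "g \<in> ?H"
      then obtain A B where A: "A \<in> ?MH" "f = op A" and B: "B \<in> ?MH" "g = op B" by blast
      have "(\<lambda>v. f v + g v) = op (A + B)"
        unfolding A(2) B(2) using op_add[OF sub[OF A(1)] sub[OF B(1)]] by (intro ext) simp
      then show "(\<lambda>v. f v + g v) \<in> ?H" using A B supported_add by blast
      let ?D = "A * B - B * A"
      have D: "?D \<in> ?MZ" using comm A B by blast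
      have "?D = mat N N (\<lambda>e. if e \<in> ?I then ?D $$ e else 0)"
        using D by (intro eq_matI) (auto simp: supported_def QZ_def)
      then have "op ?D v i = (\<Sum>e\<in>?I. ?D $$ e * ?z e v i)" for v i
        using combination[of ?I "\<lambda>e. ?D $$ e" v i, OF finI subset_refl] by simp
      then have "f (g v) - g (f v) = (\<Sum>e\<in>?I. (\<lambda>i. ?D $$ e * ?z e v i))" for v
        unfolding A(2) B(2) using op_comm[OF sub[OF A(1)] sub[OF B(1)]] by (intro ext) (simp add: sum_fun)
      then show "\<exists>c. \<forall>v. f (g v) - g (f v) = (\<Sum>e\<in>?I. (\<lambda>i. c e * ?z e v i))"
        by (intro exI[of _ "\<lambda>e. ?D $$ e"]) blast
    next
      fix f c assume "f \<in> ?H"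
      then obtain A where A: "A \<in> ?MH" "f = op A" by blast
      have "(\<lambda>v i. c * f v i) = op (c \<cdot>\<^sub>m A)"
        unfolding A(2) using op_smult[OF sub[OF A(1)]] by (intro ext) simp
      then show "(\<lambda>v i. c * f v i) \<in> ?H" using A supported_smult by blast
    qed (fact finI I_nonempty zH z_central m faithful)+
    then show ?thesis using twice_le_add_of_square_le_mult[of a] unfolding cardI N_def by force
  qed
  then show ?thesis using dimV unfolding N by linarith
qed

theorem mainTheorem3:
  fixes a p :: nat
  assumes "a \<ge> 1" and "p \<ge> 1" and "(a, p) \<noteq> (1, 1)"
  shows "mu (strict_block_upper a p :: ('k :: field_char_0, 'k mat) lie_alg) = (p + 1) * a"
proof (rule antisym)
  let ?L = "strict_block_upper a p :: ('k, 'k mat) lie_alg"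
  let ?K = "class_ring :: 'k ring"
  interpret W: vec_space "TYPE('k)" "(p + 1) * a" .
  show "mu ?L \<le> (p + 1) * a"
    using mu_le[OF standard_representation W.fin_dim] by (simp only: W.dim_is_n)
  let ?P = "\<lambda>d. \<exists>(V :: ('k, 'k vec) module) rep. faithful_representation ?K ?L V rep \<and>
      vectorspace.fin_dim ?K V \<and> vectorspace.dim ?K V = d"
  have "?P ((p + 1) * a)" using standard_representation W.fin_dim W.dim_is_n by blast
  then have "?P (mu ?L)" unfolding mu_def by (rule LeastI)
  then obtain V :: "('k, 'k vec) module" and rep where V: "faithful_representation ?K ?L V rep"
    "vectorspace.fin_dim ?K V" "vectorspace.dim ?K V = mu ?L" by blast
  show "(p + 1) * a \<le> mu ?L"
    using strict_block_upper_lower_bound[OF V(1,2) assms] V(3) by simp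
qed

end
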